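(* For every $\varepsilon>0$ there exists a constant $C_0>0$, depending only on $\varepsilon$, such that the following holds. Let $E$ be an $n\times n$ Bernoulli random matrix and let $A$ be a deterministic real $n\times n$ matrix of rank $r$ whose largest singular value satisfies $\sigma_1\ge n$. Let $\sigma_1'$ be the largest singular value of $A+E$. Then, with probability at least $1-\varepsilon$, $$\sigma_1-C_0\le\sigma_1'\le\sigma_1+C_0\sqrt r.$$
   Context: A Bernoulli random matrix has independent identically distributed entries taking the values $\pm1$ with probability $1/2$ each. *)

theory Defs
  imports "HOL-Probability.Product_PMF" "Jordan_Normal_Form.DL_Rank"
    "Jordan_Normal_Form.Char_Poly"
begin

definition singular_values :: "real mat \<Rightarrow> real set" where
  "singular_values A = sqrt ` {x. eigenvalue (transpose_mat A * A) x}"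

definition largest_singular_value :: "real mat \<Rightarrow> real" where
  "largest_singular_value A = Max (singular_values A)"

definition bernoulli_matrix :: "nat \<Rightarrow> real mat pmf" where
  "bernoulli_matrix n =
     map_pmf (Matrix.mat n n) (Pi_pmf ({..<n} \<times> {..<n}) 0 (\<lambda>_. pmf_of_set {-1, 1}))"

text \<open>
  Only the law of a Bernoulli random matrix enters a statement about probabilities, so nothing is
  lost by working with \<^const>\<open>bernoulli_matrix\<close>: every random matrix with independent uniform
  \<open>\<plusminus>1\<close> entries, on an arbitrary probability space, has this law.
\<close>
lemma (in prob_space) prob_bernoulli_matrix:
  fixes X :: "nat \<times> nat \<Rightarrow> 'a \<Rightarrow> real"
  assumes indep: "indep_vars (\<lambda>_. borel) X ({..<n} \<times> {..<n})"
    and neg: "\<And>i. i \<in> {..<n} \<times> {..<n} \<Longrightarrow> prob {\<omega> \<in> space M. X i \<omega> = -1} = 1 / 2"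
    and pos: "\<And>i. i \<in> {..<n} \<times> {..<n} \<Longrightarrow> prob {\<omega> \<in> space M. X i \<omega> = 1} = 1 / 2"
    and meas: "{\<omega> \<in> space M. P (Matrix.mat n n (\<lambda>i. X i \<omega>))} \<in> events"
  shows "prob {\<omega> \<in> space M. P (Matrix.mat n n (\<lambda>i. X i \<omega>))} =
           measure_pmf.prob (bernoulli_matrix n) {E. P E}"
proof -
  define I where "I = {..<n} \<times> {..<n}"
  define F where "F = PiE_dflt I (0::real) (\<lambda>_. {-1, 1})"
  define B where "B f = {\<omega> \<in> space M. \<forall>i\<in>I. X i \<omega> = f i}" for f :: "nat \<times> nat \<Rightarrow> real"
  have finI: "finite I" by (simp add: I_def)
  have finF: "finite F" unfolding F_def using finI by (intro finite_PiE_dflt) auto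
  have Fval: "f i = -1 \<or> f i = 1" if "f \<in> F" "i \<in> I" for f i
    using that by (cases i) (auto simp: F_def PiE_dflt_def)
  have Fout: "f i = 0" if "f \<in> F" "i \<notin> I" for f i
    using that by (cases i) (auto simp: F_def PiE_dflt_def)
  have rv: "random_variable borel (X i)" if "i \<in> I" for i
    using indep that by (auto simp: indep_vars_def I_def)
  have single: "{\<omega> \<in> space M. X i \<omega> = c} \<in> events" if "i \<in> I" for i c
    using rv[OF that] by measurable
  have Bev: "B f \<in> events" for f
    unfolding B_def using finI single by (intro sets.sets_Collect_finite_All) auto
  have Bprob: "prob (B f) = (1 / 2) ^ card I" if "f \<in> F" for f
  proof (cases "I = {}")
    case True
    then show ?thesis by (simp add: B_def prob_space)
  next
    case False
    have "prob (\<Inter>i\<in>I. X i -` {f i} \<inter> space M) = (\<Prod>i\<in>I. prob (X i -` {f i} \<inter> space M))"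
      using indep False finI by (intro indep_varsD[where I = I]) (auto simp: I_def)
    also have "(\<Inter>i\<in>I. X i -` {f i} \<inter> space M) = B f"
      using False by (auto simp: B_def)
    also have "(\<Prod>i\<in>I. prob (X i -` {f i} \<inter> space M)) = (\<Prod>i\<in>I. 1 / 2)"
    proof (rule prod.cong)
      fix i assume i: "i \<in> I"
      have "X i -` {f i} \<inter> space M = {\<omega> \<in> space M. X i \<omega> = f i}" by auto
      moreover have "f i = -1 \<or> f i = 1" using Fval that i by blast
      ultimately show "prob (X i -` {f i} \<inter> space M) = 1 / 2"
        using neg[of i] pos[of i] i by (auto simp: I_def)
    qed simp
    finally show ?thesis by simp
  qed
  have disj: "disjoint_family_on B F"
  proof (unfold disjoint_family_on_def, intro ballI impI)
    fix f g assume fg: "f \<in> F" "g \<in> F" "f \<noteq> g"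
    then obtain i where "f i \<noteq> g i" by (meson ext)
    with fg have "i \<in> I" using Fout[of f i] Fout[of g i] by auto
    with \<open>f i \<noteq> g i\<close> show "B f \<inter> B g = {}" by (auto simp: B_def)
  qed
  have pm: "AE \<omega> in M. \<forall>i\<in>I. X i \<omega> = -1 \<or> X i \<omega> = 1"
  proof (rule AE_finite_allI[OF finI])
    fix i assume i: "i \<in> I"
    have "prob ({\<omega> \<in> space M. X i \<omega> = -1} \<union> {\<omega> \<in> space M. X i \<omega> = 1}) =
        prob {\<omega> \<in> space M. X i \<omega> = -1} + prob {\<omega> \<in> space M. X i \<omega> = 1}"
      using single[OF i] by (intro finite_measure_Union) auto
    also have "\<dots> = 1" using neg[of i] pos[of i] i by (simp add: I_def)
    finally have "prob ({\<omega> \<in> space M. X i \<omega> = -1} \<union> {\<omega> \<in> space M. X i \<omega> = 1}) = 1" .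
    then have "AE \<omega> in M. \<omega> \<in> {\<omega> \<in> space M. X i \<omega> = -1} \<union> {\<omega> \<in> space M. X i \<omega> = 1}"
      using single[OF i] by (subst (asm) prob_eq_1) auto
    then show "AE \<omega> in M. X i \<omega> = -1 \<or> X i \<omega> = 1" by eventually_elim auto
  qed
  define G where "G = {f \<in> F. P (Matrix.mat n n f)}"
  have GF: "G \<subseteq> F" and finG: "finite G" using finF by (auto simp: G_def)
  have mat_eq: "Matrix.mat n n (\<lambda>i. X i \<omega>) = Matrix.mat n n f" if "\<omega> \<in> B f" for \<omega> f
    using that by (auto simp: B_def I_def)
  have "prob {\<omega> \<in> space M. P (Matrix.mat n n (\<lambda>i. X i \<omega>))} = prob (\<Union>f\<in>G. B f)"
  proof (rule finite_measure_eq_AE[OF _ meas])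
    show "AE \<omega> in M. \<omega> \<in> {\<omega> \<in> space M. P (Matrix.mat n n (\<lambda>i. X i \<omega>))} \<longleftrightarrow> \<omega> \<in> (\<Union>f\<in>G. B f)"
      using pm AE_space
    proof eventually_elim
      case (elim \<omega>)
      define f where "f i = (if i \<in> I then X i \<omega> else 0)" for i
      have "f \<in> F" "\<omega> \<in> B f"
        using elim by (auto simp: f_def F_def B_def PiE_dflt_def)
      then show ?case
        using mat_eq elim(2) by (fastforce simp: G_def)
    qed
    show "(\<Union>f\<in>G. B f) \<in> events" using finG Bev by auto
  qed
  also have "\<dots> = (\<Sum>f\<in>G. prob (B f))"
    using finG Bev disj GF
    by (intro finite_measure_finite_Union) (auto simp: disjoint_family_on_def subset_iff)
  also have "\<dots> = (\<Sum>f\<in>G. (1 / 2) ^ card I)"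
    using GF by (intro sum.cong refl Bprob) auto
  also have "\<dots> = (\<Sum>f\<in>G. pmf (Pi_pmf I 0 (\<lambda>_. pmf_of_set {-1, 1})) f)"
  proof (intro sum.cong refl)
    fix f assume "f \<in> G"
    then have f: "f \<in> F" using GF by auto
    have "pmf (Pi_pmf I 0 (\<lambda>_. pmf_of_set {-1, 1})) f = (\<Prod>i\<in>I. pmf (pmf_of_set {-1, 1}) (f i))"
      using Fout[OF f] finI by (subst pmf_Pi') auto
    also have "\<dots> = (\<Prod>i\<in>I. 1 / 2)"
      using Fval[OF f] by (intro prod.cong refl) (fastforce simp: indicator_def)
    finally show "(1 / 2) ^ card I = pmf (Pi_pmf I 0 (\<lambda>_. pmf_of_set {-1, 1})) f" by simp
  qed
  also have "\<dots> = measure_pmf.prob (Pi_pmf I 0 (\<lambda>_. pmf_of_set {-1, 1})) G"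
    using finG by (simp add: measure_measure_pmf_finite)
  also have "\<dots> = measure_pmf.prob (Pi_pmf I 0 (\<lambda>_. pmf_of_set {-1, 1})) (Matrix.mat n n -` {E. P E})"
  proof (rule measure_pmf.finite_measure_eq_AE)
    have "set_pmf (Pi_pmf I 0 (\<lambda>_. pmf_of_set {-1, 1::real})) \<subseteq> F"
      using set_Pi_pmf_subset'[OF finI, of 0 "\<lambda>_. pmf_of_set {-1, 1::real}"] by (simp add: F_def comp_def)
    then show "AE f in Pi_pmf I 0 (\<lambda>_. pmf_of_set {-1, 1}). f \<in> G \<longleftrightarrow> f \<in> Matrix.mat n n -` {E. P E}"
      by (auto simp: AE_measure_pmf_iff G_def)
  qed auto
  also have "\<dots> = measure_pmf.prob (bernoulli_matrix n) {E. P E}"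
    by (simp add: bernoulli_matrix_def I_def)
  finally show ?thesis .
qed

end

theory Submission
  imports Defs "HOL-Probability.Hoeffding"
begin

text \<open>
  The largest singular value is the maximum of \<open>x\<^sup>T A y\<close> over unit vectors. Testing \<open>A + E\<close> on the top singular
  pair of \<open>A\<close> gives the lower bound, since \<open>x\<^sup>T E y\<close> is subgaussian with variance 1. For the upper
  bound, let \<open>U\<close>, \<open>V\<close> be the column and row spaces of \<open>A\<close>, of dimension at most \<open>r\<close>, and split
  \<open>x = x\<^sub>1 + x\<^sub>2\<close>, \<open>y = y\<^sub>1 + y\<^sub>2\<close> along \<open>U\<close>, \<open>V\<close> and their complements. A net argument bounds \<open>E\<close>
  on \<open>U \<times> V\<close> by a multiple of \<open>sqrt r\<close> and on the whole space by a multiple of \<open>sqrt n\<close>. The cross terms,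
  of order \<open>sqrt n (|x\<^sub>2| + |y\<^sub>2|)\<close>, are absorbed by the loss \<open>\<sigma>\<^sub>1 (|x\<^sub>2|\<^sup>2 + |y\<^sub>2|\<^sup>2) / 2\<close> in the main term,
  because \<open>\<sigma>\<^sub>1 \<ge> n\<close>; only a constant remains.
\<close>

section \<open>Bilinear forms on coordinate vectors\<close>

text \<open>Vectors and matrices are plain functions, read only at indices below the bounds, so that
  entries \<open>($$) A\<close> and random sign functions enter directly. Separate \<open>k\<close>
  and \<open>l\<close> allow for forms restricted to two different subspaces.\<close>

definition bilin :: "nat \<Rightarrow> nat \<Rightarrow> (nat \<times> nat \<Rightarrow> real) \<Rightarrow> (nat \<Rightarrow> real) \<Rightarrow> (nat \<Rightarrow> real) \<Rightarrow> real" where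
  "bilin k l f x y = (\<Sum>i<k. \<Sum>j<l. f (i, j) * x i * y j)"

definition dotp :: "nat \<Rightarrow> (nat \<Rightarrow> real) \<Rightarrow> (nat \<Rightarrow> real) \<Rightarrow> real" where
  "dotp n x y = (\<Sum>i<n. x i * y i)"

abbreviation norm2 :: "nat \<Rightarrow> (nat \<Rightarrow> real) \<Rightarrow> real" where
  "norm2 n x \<equiv> L2_set x {..<n}"

lemma norm2_power2: "(norm2 n x)\<^sup>2 = dotp n x x"
  by (simp add: L2_set_def dotp_def power2_eq_square sum_nonneg)

lemma norm2_eq_sqrt: "norm2 n x = sqrt (dotp n x x)"
  by (simp add: L2_set_def dotp_def power2_eq_square)

lemma dotp_self_eq_0D:
  assumes "dotp n x x = 0" "i < n" shows "x i = 0"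
proof -
  have "L2_set x {..<n} = 0" unfolding norm2_eq_sqrt assms by simp
  then show ?thesis using assms(2) L2_set_eq_0_iff[of "{..<n}" x] by blast
qed

lemma dotp_commute: "dotp n x y = dotp n y x"
  by (simp add: dotp_def mult.commute)

lemma dotp_cong:
  assumes "\<And>i. i < n \<Longrightarrow> x i = x' i" "\<And>i. i < n \<Longrightarrow> y i = y' i"
  shows "dotp n x y = dotp n x' y'"
  unfolding dotp_def using assms by (intro sum.cong) auto

lemma dotp_diff_left: "dotp n (\<lambda>i. x i - x' i) y = dotp n x y - dotp n x' y"
  by (simp add: dotp_def left_diff_distrib sum_subtractf)

lemma dotp_scale_left: "dotp n (\<lambda>i. c * x i) y = c * dotp n x y"
  by (simp add: dotp_def sum_distrib_left mult.assoc)

lemma dotp_scale_right: "dotp n x (\<lambda>i. c * y i) = c * dotp n x y"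
  by (simp add: dotp_def sum_distrib_left mult_ac)

lemma dotp_scale_self: "dotp n (\<lambda>i. c * x i) (\<lambda>i. c * x i) = c\<^sup>2 * dotp n x x"
  by (simp add: dotp_def sum_distrib_left power2_eq_square mult_ac)

lemma dotp_sum_left: "dotp n (\<lambda>i. \<Sum>j\<in>J. c j * u j i) y = (\<Sum>j\<in>J. c j * dotp n (u j) y)"
  by (simp add: dotp_def sum_distrib_right sum_distrib_left mult.assoc sum.swap[of _ "{..<n}"])

lemma dotp_le_norm2: "dotp n x y \<le> norm2 n x * norm2 n y"
proof -
  have "dotp n x y \<le> (\<Sum>i<n. \<bar>x i\<bar> * \<bar>y i\<bar>)"
    unfolding dotp_def by (intro sum_mono) (metis abs_ge_self abs_mult)
  also have "\<dots> \<le> norm2 n x * norm2 n y" by (rule L2_set_mult_ineq)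
  finally show ?thesis .
qed

lemma norm2_scale: "norm2 n (\<lambda>i. c * x i) = \<bar>c\<bar> * norm2 n x"
  by (simp add: L2_set_def power_mult_distrib sum_distrib_left[symmetric] real_sqrt_mult)

lemma bilin_cong:
  assumes "\<And>i j. i < k \<Longrightarrow> j < l \<Longrightarrow> f (i, j) = f' (i, j)"
    and "\<And>i. i < k \<Longrightarrow> x i = x' i" "\<And>j. j < l \<Longrightarrow> y j = y' j"
  shows "bilin k l f x y = bilin k l f' x' y'"
  unfolding bilin_def using assms by (intro sum.cong) auto

lemma bilin_add_fun: "bilin k l (\<lambda>p. f p + g p) x y = bilin k l f x y + bilin k l g x y"
  by (simp add: bilin_def distrib_right sum.distrib)

lemma bilin_add_left: "bilin k l f (\<lambda>i. x i + x' i) y = bilin k l f x y + bilin k l f x' y"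
  by (simp add: bilin_def distrib_left distrib_right sum.distrib)

lemma bilin_add_right: "bilin k l f x (\<lambda>j. y j + y' j) = bilin k l f x y + bilin k l f x y'"
  by (simp add: bilin_def distrib_left distrib_right sum.distrib)

lemma bilin_scale_left: "bilin k l f (\<lambda>i. c * x i) y = c * bilin k l f x y"
  by (simp add: bilin_def sum_distrib_left mult_ac)

lemma bilin_scale_right: "bilin k l f x (\<lambda>j. c * y j) = c * bilin k l f x y"
  by (simp add: bilin_def sum_distrib_left mult_ac)

lemma bilin_dotp_right: "bilin k l f x y = dotp k x (\<lambda>i. \<Sum>j<l. f (i, j) * y j)"
  by (simp add: bilin_def dotp_def sum_distrib_left mult_ac)

lemma bilin_dotp_left: "bilin k l f x y = dotp l (\<lambda>j. \<Sum>i<k. f (i, j) * x i) y"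
  unfolding bilin_def dotp_def by (subst sum.swap) (simp add: sum_distrib_right)

lemma bilin_zero_left:
  assumes "norm2 k x = 0" shows "bilin k l f x y = 0"
  using assms by (simp add: bilin_def L2_set_eq_0_iff)

lemma bilin_zero_right:
  assumes "norm2 l y = 0" shows "bilin k l f x y = 0"
  using assms by (simp add: bilin_def L2_set_eq_0_iff)

text \<open>By homogeneity: rescale both vectors to unit length. If one of them has norm zero, both
  sides vanish.\<close>

lemma bilin_le_of_unit:
  assumes S: "\<And>x y. norm2 k x \<le> 1 \<Longrightarrow> norm2 l y \<le> 1 \<Longrightarrow> bilin k l f x y \<le> S"
  shows "bilin k l f x y \<le> S * norm2 k x * norm2 l y"
proof (cases "norm2 k x = 0 \<or> norm2 l y = 0")
  case True
  then show ?thesis using bilin_zero_left bilin_zero_right by auto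
next
  case False
  define a b where "a = norm2 k x" and "b = norm2 l y"
  have ab: "a > 0" "b > 0" using False by (auto simp: a_def b_def less_le)
  have "bilin k l f (\<lambda>i. inverse a * x i) (\<lambda>j. inverse b * y j) \<le> S"
    using ab by (intro S) (auto simp: norm2_scale simp flip: a_def b_def)
  then have "inverse a * (inverse b * bilin k l f x y) \<le> S"
    by (simp add: bilin_scale_left bilin_scale_right)
  then show ?thesis using ab unfolding a_def[symmetric] b_def[symmetric] by (simp add: field_simps)
qed

text \<open>A crude bound that serves to make the supremum over unit vectors exist.\<close>

lemma bilin_unit_le:
  assumes "norm2 k x \<le> 1" "norm2 l y \<le> 1"
  shows "bilin k l f x y \<le> (\<Sum>i<k. \<Sum>j<l. \<bar>f (i, j)\<bar>)"
  unfolding bilin_def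
proof (intro sum_mono)
  fix i j assume ij: "i \<in> {..<k}" "j \<in> {..<l}"
  have "\<bar>x i\<bar> \<le> norm2 k x"
    using member_le_L2_set[OF _ ij(1), of "\<lambda>i. \<bar>x i\<bar>"] by (simp add: L2_set_def)
  moreover have "\<bar>y j\<bar> \<le> norm2 l y"
    using member_le_L2_set[OF _ ij(2), of "\<lambda>i. \<bar>y i\<bar>"] by (simp add: L2_set_def)
  ultimately have "\<bar>x i * y j\<bar> \<le> 1" using assms by (simp add: abs_mult mult_le_one)
  then have "\<bar>f (i, j)\<bar> * \<bar>x i * y j\<bar> \<le> \<bar>f (i, j)\<bar>" by (simp add: mult_left_le)
  then show "f (i, j) * x i * y j \<le> \<bar>f (i, j)\<bar>" by (simp add: abs_mult[symmetric] mult.assoc)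
qed

section \<open>Orthonormal systems and forms restricted to their spans\<close>

definition comb :: "nat \<Rightarrow> (nat \<Rightarrow> nat \<Rightarrow> real) \<Rightarrow> (nat \<Rightarrow> real) \<Rightarrow> nat \<Rightarrow> real" where
  "comb k u x i = (\<Sum>a<k. x a * u a i)"

definition orthonormal :: "nat \<Rightarrow> nat \<Rightarrow> (nat \<Rightarrow> nat \<Rightarrow> real) \<Rightarrow> bool" where
  "orthonormal n k u \<longleftrightarrow> (\<forall>a<k. \<forall>b<k. dotp n (u a) (u b) = (if a = b then 1 else 0))"

lemma dotp_comb_left: "dotp n (comb k u x) y = (\<Sum>a<k. x a * dotp n (u a) y)"
  using dotp_sum_left[of n x u "{..<k}" y] by (simp add: comb_def[abs_def])

lemma dotp_comb_orthonormal:
  assumes "orthonormal n k u" "b < k"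
  shows "dotp n (comb k u x) (u b) = x b"
proof -
  have "dotp n (comb k u x) (u b) = (\<Sum>a<k. if a = b then x a else 0)"
    unfolding dotp_comb_left using assms by (intro sum.cong) (auto simp: orthonormal_def)
  then show ?thesis using assms(2) by simp
qed

lemma norm2_comb:
  assumes "orthonormal n k u" shows "norm2 n (comb k u x) = norm2 k x"
proof -
  have "dotp n (comb k u x) (comb k u x) = (\<Sum>a<k. x a * dotp n (comb k u x) (u a))"
    by (subst dotp_comb_left) (simp add: dotp_commute)
  also have "\<dots> = dotp k x x"
    unfolding dotp_def[of k] using assms by (intro sum.cong) (auto simp: dotp_comb_orthonormal)
  finally have "(norm2 n (comb k u x))\<^sup>2 = (norm2 k x)\<^sup>2" by (simp add: norm2_power2)
  then show ?thesis by simp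
qed

text \<open>Restricted to two spans, a form becomes one in \<open>k\<close> and \<open>l\<close>
  coordinates. A net for it then has size exponential in the dimensions of the subspaces and not in
  \<open>n\<close>.\<close>

lemma bilin_comb:
  "bilin n m f (comb k u x) (comb l v y) = bilin k l (\<lambda>(a, b). bilin n m f (u a) (v b)) x y"
proof -
  have "bilin n m f (comb k u x) z = (\<Sum>a<k. x a * bilin n m f (u a) z)" for z
    unfolding bilin_dotp_right by (rule dotp_comb_left)
  moreover have "bilin n m f z (comb l v y) = (\<Sum>b<l. y b * bilin n m f z (v b))" for z
    unfolding bilin_dotp_left by (subst dotp_commute, subst dotp_comb_left, simp add: dotp_commute)
  ultimately show ?thesis
    by (simp add: bilin_def[of k] sum_distrib_left mult_ac) (rule sum.swap)
qed

section \<open>Lattice nets\<close>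

text \<open>The box \<open>{- int m..int m}\<close> places the ball inside a finite product, over
  which a product weight can be summed coordinate by coordinate.\<close>

definition lattice_ball :: "nat \<Rightarrow> nat \<Rightarrow> (nat \<Rightarrow> int) set" where
  "lattice_ball k m = {z \<in> {..<k} \<rightarrow>\<^sub>E {- int m..int m}. (\<Sum>i<k. (z i)\<^sup>2) \<le> int m}"

lemma finite_lattice_ball [simp]: "finite (lattice_ball k m)"
  by (simp add: lattice_ball_def finite_PiE)

lemma abs_le_power2_int: "\<bar>z\<bar> \<le> z\<^sup>2" for z :: int
proof (cases "z = 0")
  case False
  then have "1 * \<bar>z\<bar> \<le> \<bar>z\<bar> * \<bar>z\<bar>" by (intro mult_right_mono) auto
  then show ?thesis by (simp add: power2_eq_square)
qed simp

text \<open>Partial sums of a two-sided geometric series; the induction runs on their exact value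
  \<open>3 - 2 * (1 / 2) ^ m\<close>.\<close>

lemma sum_half_power_abs: "(\<Sum>z = - int m..int m. (1 / 2 :: real) ^ nat \<bar>z\<bar>) \<le> 3"
proof -
  have "(\<Sum>z = - int m..int m. (1 / 2 :: real) ^ nat \<bar>z\<bar>) = 3 - 2 * (1 / 2) ^ m"
  proof (induction m)
    case (Suc m)
    have "{- int (Suc m)..int (Suc m)} = insert (- int (Suc m)) (insert (int (Suc m)) {- int m..int m})"
      by auto
    then show ?case using Suc by (simp add: nat_add_distrib)
  qed simp
  then show ?thesis by simp
qed

text \<open>Every point \<open>z\<close> of the ball has weight \<open>\<Prod>\<^sub>i (1 / 2) ^ |z\<^sub>i| \<ge> (1 / 2) ^ m\<close>, and the total
  mass of this weight is at most \<open>3\<close> per coordinate.\<close>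
lemma card_lattice_ball: "real (card (lattice_ball k m)) \<le> 2 ^ m * 3 ^ k"
proof -
  let ?w = "\<lambda>z. \<Prod>i<k. (1 / 2 :: real) ^ nat \<bar>z i\<bar>"
  have "real (card (lattice_ball k m)) * (1 / 2) ^ m = (\<Sum>z\<in>lattice_ball k m. (1 / 2) ^ m)"
    by simp
  also have "\<dots> \<le> (\<Sum>z\<in>lattice_ball k m. ?w z)"
  proof (rule sum_mono)
    fix z assume z: "z \<in> lattice_ball k m"
    \<comment> \<open>An integer is bounded in absolute value by its square, so the squared radius
      also bounds the sum of absolute values.\<close>
    have "(\<Sum>i<k. nat \<bar>z i\<bar>) \<le> m"
    proof -
      have "int (\<Sum>i<k. nat \<bar>z i\<bar>) = (\<Sum>i<k. \<bar>z i\<bar>)" by simp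
      also have "\<dots> \<le> (\<Sum>i<k. (z i)\<^sup>2)"
        by (intro sum_mono abs_le_power2_int)
      also have "\<dots> \<le> int m" using z by (simp add: lattice_ball_def)
      finally show ?thesis by (simp only: of_nat_le_iff)
    qed
    then have "(1 / 2 :: real) ^ m \<le> (1 / 2) ^ (\<Sum>i<k. nat \<bar>z i\<bar>)" by (intro power_decreasing) auto
    then show "(1 / 2) ^ m \<le> ?w z" by (simp add: power_sum)
  qed
  also have "\<dots> \<le> (\<Sum>z\<in>{..<k} \<rightarrow>\<^sub>E {- int m..int m}. ?w z)"
  proof (rule sum_mono2)
    show "lattice_ball k m \<subseteq> {..<k} \<rightarrow>\<^sub>E {- int m..int m}" unfolding lattice_ball_def by blast
    show "0 \<le> ?w z" for z by (rule prod_nonneg) simp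
  qed (simp add: finite_PiE)
  also have "\<dots> = (\<Prod>i<k. \<Sum>z = - int m..int m. (1 / 2) ^ nat \<bar>z\<bar>)"
    by (rule prod_sum_PiE[symmetric]) auto
  also have "\<dots> \<le> (\<Prod>i<k. 3)"
    by (intro prod_mono conjI sum_half_power_abs sum_nonneg) auto
  finally show ?thesis by (simp add: field_simps power_divide)
qed

text \<open>The mesh \<open>1 / (4 * sqrt r)\<close> turns the squared radius \<open>16 * r\<close>
  into 1. It depends on \<open>r\<close> and not on \<open>k\<close>, so that one mesh serves both
  arguments of a form.\<close>

definition lattice_net :: "nat \<Rightarrow> nat \<Rightarrow> (nat \<Rightarrow> real) set" where
  "lattice_net k r = (\<lambda>z i. z i / (4 * sqrt r)) ` lattice_ball k (16 * r)"

lemma finite_lattice_net [simp]: "finite (lattice_net k r)"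
  by (simp add: lattice_net_def)

lemma card_lattice_net:
  assumes "k \<le> r" shows "real (card (lattice_net k r)) \<le> (2 ^ 16 * 3) ^ r"
proof -
  have "real (card (lattice_net k r)) \<le> real (card (lattice_ball k (16 * r)))"
    unfolding lattice_net_def by (simp add: card_image_le)
  also have "\<dots> \<le> 2 ^ (16 * r) * 3 ^ k" by (rule card_lattice_ball)
  also have "\<dots> \<le> 2 ^ (16 * r) * 3 ^ r" using assms by (simp add: power_increasing)
  also have "\<dots> = (2 ^ 16 * 3) ^ r" by (simp only: power_mult power_mult_distrib)
  finally show ?thesis .
qed

lemma norm2_lattice_net:
  assumes "z \<in> lattice_net k r" "r \<ge> 1" shows "norm2 k z \<le> 1"
proof -
  obtain a where a: "a \<in> lattice_ball k (16 * r)" and z: "z = (\<lambda>i. a i / (4 * sqrt r))"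
    using assms(1) by (auto simp: lattice_net_def)
  have "(\<Sum>i<k. (a i)\<^sup>2) \<le> int (16 * r)" using a by (simp add: lattice_ball_def)
  then have "real_of_int (\<Sum>i<k. (a i)\<^sup>2) \<le> 16 * real r" by linarith
  then have "(\<Sum>i<k. (real_of_int (a i))\<^sup>2) \<le> 16 * real r" by simp
  moreover have "(\<Sum>i<k. (z i)\<^sup>2) = (\<Sum>i<k. (real_of_int (a i))\<^sup>2) / (16 * r)"
    by (simp add: z power_divide power_mult_distrib sum_divide_distrib)
  ultimately show ?thesis using assms(2) by (simp add: L2_set_def)
qed

text \<open>Rounding goes towards zero: this never enlarges a coordinate, so a rounded vector stays
  in the ball.\<close>

lemma truncate_to_int: "\<exists>z::int. \<bar>real_of_int z\<bar> \<le> \<bar>a\<bar> \<and> \<bar>a - z\<bar> \<le> 1" for a :: real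
proof (cases "a \<ge> 0")
  case True
  then have "\<lfloor>a\<rfloor> \<ge> 0" by simp
  then show ?thesis using True by (intro exI[of _ "\<lfloor>a\<rfloor>"] conjI; linarith)
next
  case False
  then have "\<lceil>a\<rceil> \<le> 0" by simp
  then show ?thesis using False by (intro exI[of _ "\<lceil>a\<rceil>"] conjI; linarith)
qed

text \<open>Scale by \<open>h = 4 * sqrt r\<close> and round towards zero. Each of the
  \<open>k \<le> r\<close> coordinates of \<open>x\<close> then moves by at most
  \<open>1 / h\<close>, so the total error is at most \<open>sqrt k / h \<le> 1 / 4\<close>.\<close>

lemma lattice_net_approx:
  assumes x: "norm2 k x \<le> 1" and r: "r \<ge> 1" "k \<le> r"
  obtains z where "z \<in> lattice_net k r" "norm2 k (\<lambda>i. x i - z i) \<le> 1 / 4"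
proof -
  define h where "h = 4 * sqrt r"
  have h: "h > 0" "h\<^sup>2 = 16 * real r" using r by (auto simp: h_def power_mult_distrib)
  obtain a :: "nat \<Rightarrow> int" where
    a: "\<And>i. \<bar>real_of_int (a i)\<bar> \<le> \<bar>h * x i\<bar>" "\<And>i. \<bar>h * x i - a i\<bar> \<le> 1"
  proof -
    have "\<forall>i. \<exists>z::int. \<bar>real_of_int z\<bar> \<le> \<bar>h * x i\<bar> \<and> \<bar>h * x i - z\<bar> \<le> 1"
      using truncate_to_int by blast
    then show ?thesis using that by metis
  qed
  define b where "b = restrict a {..<k}"
  have xsq: "(\<Sum>i<k. (x i)\<^sup>2) \<le> 1" using x by (simp add: L2_set_def)
  have "(\<Sum>i<k. (real_of_int (a i))\<^sup>2) \<le> (\<Sum>i<k. (h * x i)\<^sup>2)"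
    by (intro sum_mono) (use a(1) abs_le_square_iff in blast)
  also have "\<dots> = 16 * real r * (\<Sum>i<k. (x i)\<^sup>2)"
    by (simp add: power_mult_distrib h sum_distrib_left)
  also have "\<dots> \<le> 16 * real r" using xsq by (simp add: mult_left_le)
  finally have "real_of_int (\<Sum>i<k. (a i)\<^sup>2) \<le> real_of_int (int (16 * r))" by simp
  then have sq: "(\<Sum>i<k. (a i)\<^sup>2) \<le> int (16 * r)" by linarith
  have "\<bar>a i\<bar> \<le> int (16 * r)" if "i < k" for i
  proof -
    have "\<bar>a i\<bar> \<le> (a i)\<^sup>2" by (rule abs_le_power2_int)
    also have "\<dots> \<le> (\<Sum>i<k. (a i)\<^sup>2)" using that by (intro member_le_sum) auto
    finally show ?thesis using sq by linarith
  qed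
  then have b: "b \<in> lattice_ball k (16 * r)"
    using sq by (force simp: lattice_ball_def b_def PiE_iff abs_le_iff)
  show ?thesis
  proof (rule that)
    show "(\<lambda>i. b i / h) \<in> lattice_net k r" using b unfolding lattice_net_def h_def by blast
    have "(\<Sum>i<k. (x i - b i / h)\<^sup>2) \<le> (\<Sum>i<k. 1 / (16 * real r))"
    proof (rule sum_mono)
      fix i assume "i \<in> {..<k}"
      then have "x i - b i / h = (h * x i - a i) / h" using h by (simp add: b_def field_simps)
      then have "(x i - b i / h)\<^sup>2 = (h * x i - a i)\<^sup>2 / (16 * real r)" using h by (simp add: power_divide)
      moreover have "(h * x i - a i)\<^sup>2 \<le> 1" using a(2)[of i] by (simp add: abs_square_le_1)
      ultimately show "(x i - b i / h)\<^sup>2 \<le> 1 / (16 * real r)" by (simp add: divide_right_mono)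
    qed
    also have "\<dots> \<le> (1 / 4)\<^sup>2" using r by (simp add: field_simps power2_eq_square)
    finally show "norm2 k (\<lambda>i. x i - b i / h) \<le> 1 / 4"
      unfolding L2_set_def by (intro real_le_lsqrt) auto
  qed
qed

text \<open>A self-improving estimate for the supremum \<open>Sup X\<close> over unit vectors:
  moving \<open>x\<close> and then \<open>y\<close> to net points costs at most
  \<open>Sup X / 4\<close> each, hence \<open>Sup X \<le> t + Sup X / 2\<close>. Homogeneity extends
  the bound to all vectors.\<close>

lemma bilin_le_of_net:
  assumes r: "r \<ge> 1" "k \<le> r" "l \<le> r"
    and t: "\<And>z w. z \<in> lattice_net k r \<Longrightarrow> w \<in> lattice_net l r \<Longrightarrow> bilin k l f z w \<le> t"
  shows "bilin k l f x y \<le> 2 * t * norm2 k x * norm2 l y"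
proof -
  define X where "X = {bilin k l f x y |x y. norm2 k x \<le> 1 \<and> norm2 l y \<le> 1}"
  have bdd: "bdd_above X" unfolding X_def bdd_above_def using bilin_unit_le by blast
  have S: "bilin k l f x y \<le> Sup X" if "norm2 k x \<le> 1" "norm2 l y \<le> 1" for x y
    using that by (intro cSup_upper bdd) (auto simp: X_def)
  \<comment> \<open>The zero vectors show that \<open>Sup X\<close> is nonnegative, so that it can
    be multiplied into the norm estimates below.\<close>
  have "bilin k l f (\<lambda>_. 0) (\<lambda>_. 0) \<le> Sup X" by (intro S) (auto simp: L2_set_def)
  then have S0: "Sup X \<ge> 0" by (simp add: bilin_def)
  note hom = bilin_le_of_unit[OF S]
  have "bilin k l f x y \<le> t + Sup X / 2" if xy: "norm2 k x \<le> 1" "norm2 l y \<le> 1" for x y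
  proof -
    obtain z where z: "z \<in> lattice_net k r" "norm2 k (\<lambda>i. x i - z i) \<le> 1 / 4"
      using lattice_net_approx xy r by metis
    obtain w where w: "w \<in> lattice_net l r" "norm2 l (\<lambda>i. y i - w i) \<le> 1 / 4"
      using lattice_net_approx xy r by metis
    have nz: "norm2 k z \<le> 1" using z r norm2_lattice_net by blast
    have "bilin k l f x y = bilin k l f (\<lambda>i. z i + (x i - z i)) y" by simp
    also have "\<dots> = bilin k l f z (\<lambda>j. w j + (y j - w j)) + bilin k l f (\<lambda>i. x i - z i) y"
      by (simp only: bilin_add_left) simp
    also have "\<dots> = bilin k l f z w + bilin k l f z (\<lambda>j. y j - w j) + bilin k l f (\<lambda>i. x i - z i) y"
      by (simp only: bilin_add_right)
    also have "\<dots> \<le> t + Sup X / 4 + Sup X / 4"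
    proof (intro add_mono)
      show "bilin k l f z w \<le> t" using z w t by blast
      have "bilin k l f z (\<lambda>j. y j - w j) \<le> Sup X * (norm2 k z * norm2 l (\<lambda>j. y j - w j))"
        using hom by (simp add: mult.assoc)
      also have "\<dots> \<le> Sup X * (1 * (1 / 4))"
        using S0 nz w by (intro mult_left_mono mult_mono) auto
      finally show "bilin k l f z (\<lambda>j. y j - w j) \<le> Sup X / 4" by simp
      have "bilin k l f (\<lambda>i. x i - z i) y \<le> Sup X * (norm2 k (\<lambda>i. x i - z i) * norm2 l y)"
        using hom by (simp add: mult.assoc)
      also have "\<dots> \<le> Sup X * ((1 / 4) * 1)"
        using S0 xy z by (intro mult_left_mono mult_mono) auto
      finally show "bilin k l f (\<lambda>i. x i - z i) y \<le> Sup X / 4" by simp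
    qed
    finally show ?thesis by simp
  qed
  then have "Sup X \<le> t + Sup X / 2"
    by (intro cSup_least) (auto simp: X_def L2_set_def intro!: exI[of _ "\<lambda>_. 0"])
  then have "Sup X \<le> 2 * t" by simp
  then have "bilin k l f x y \<le> 2 * t" if "norm2 k x \<le> 1" "norm2 l y \<le> 1" for x y
    using S[OF that] by linarith
  then show ?thesis by (rule bilin_le_of_unit)
qed

section \<open>Tail bounds for random signs\<close>

text \<open>Hoeffding's auxiliary inequality for a fair two-point variable on an interval of length
  \<open>2 * a\<close>: its left side is the logarithm of \<open>cosh a\<close>. Evenness in
  \<open>a\<close> reduces the claim to nonnegative length.\<close>

lemma cosh_le_exp: "(exp a + exp (- a)) / 2 \<le> exp (a\<^sup>2 / 2)" for a :: real
proof -
  have *: "(exp a + exp (- a)) / 2 \<le> exp (a\<^sup>2 / 2)" if "a \<ge> 0" for a :: real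
  proof -
    have pos: "1 + 1 / 2 * (exp (2 * a) - 1) > 0" by (simp add: add_pos_pos field_simps)
    have "- (2 * a) * (1 / 2) + ln (1 + 1 / 2 * (exp (2 * a) - 1)) \<le> (2 * a)\<^sup>2 / 8"
      using that by (intro Hoeffdings_lemma_aux) auto
    then have "ln (1 + 1 / 2 * (exp (2 * a) - 1)) \<le> a + a\<^sup>2 / 2"
      by (simp add: power2_eq_square)
    then have "exp (ln (1 + 1 / 2 * (exp (2 * a) - 1))) \<le> exp (a + a\<^sup>2 / 2)" by simp
    then have "1 + 1 / 2 * (exp (2 * a) - 1) \<le> exp a * exp (a\<^sup>2 / 2)"
      using pos by (simp only: exp_ln exp_add)
    then have "exp (- a) * (1 + 1 / 2 * (exp (2 * a) - 1)) \<le> exp (- a) * (exp a * exp (a\<^sup>2 / 2))"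
      by (intro mult_left_mono) auto
    also have "\<dots> = exp (a\<^sup>2 / 2)" by (simp add: mult.assoc[symmetric] exp_add[symmetric])
    also have "exp (- a) * (1 + 1 / 2 * (exp (2 * a) - 1)) = (exp a + exp (- a)) / 2"
      by (simp add: algebra_simps exp_add[symmetric] flip: exp_double)
    finally show ?thesis .
  qed
  show ?thesis using *[of a] *[of "- a"] by (cases "a \<ge> 0") (auto simp: add.commute)
qed

text \<open>The law behind \<open>bernoulli_matrix\<close> for a general index set, before the
  passage to matrices; events are thus about sign functions.\<close>

definition signs_pmf :: "'a set \<Rightarrow> ('a \<Rightarrow> real) pmf" where
  "signs_pmf I = Pi_pmf I 0 (\<lambda>_. pmf_of_set {-1, 1})"

lemma finite_set_signs_pmf:
  assumes "finite I" shows "finite (set_pmf (signs_pmf I))"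
proof (rule finite_subset)
  show "set_pmf (signs_pmf I) \<subseteq> PiE_dflt I 0 (\<lambda>_. {-1, 1})"
    using set_Pi_pmf_subset'[OF assms, of 0 "\<lambda>_. pmf_of_set {-1, 1::real}"]
    by (simp add: signs_pmf_def comp_def)
  show "finite (PiE_dflt I 0 (\<lambda>_. {-1, 1::real}))" using assms by (intro finite_PiE_dflt) auto
qed

text \<open>Independence factors the expectation into hyperbolic cosines of the coefficients, each
  at most a Gaussian exponential.\<close>

lemma signs_mgf_le:
  assumes "finite I"
  shows "measure_pmf.expectation (signs_pmf I) (\<lambda>f. exp (\<Sum>i\<in>I. c i * f i)) \<le> exp ((\<Sum>i\<in>I. (c i)\<^sup>2) / 2)"
proof -
  have "measure_pmf.expectation (signs_pmf I) (\<lambda>f. exp (\<Sum>i\<in>I. c i * f i)) =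
      measure_pmf.expectation (signs_pmf I) (\<lambda>f. \<Prod>i\<in>I. exp (c i * f i))"
    using assms by (simp add: exp_sum)
  also have "\<dots> = (\<Prod>i\<in>I. measure_pmf.expectation (pmf_of_set {-1, 1}) (\<lambda>s. exp (c i * s)))"
    unfolding signs_pmf_def using assms
    by (intro expectation_prod_Pi_pmf integrable_measure_pmf_finite) auto
  also have "\<dots> = (\<Prod>i\<in>I. (exp (c i) + exp (- c i)) / 2)"
    by (intro prod.cong refl) (simp add: integral_pmf_of_set add.commute)
  also have "\<dots> \<le> (\<Prod>i\<in>I. exp ((c i)\<^sup>2 / 2))"
    by (intro prod_mono conjI cosh_le_exp) auto
  also have "\<dots> = exp ((\<Sum>i\<in>I. (c i)\<^sup>2) / 2)"
    using assms by (simp add: exp_sum[symmetric] sum_divide_distrib)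
  finally show ?thesis .
qed

text \<open>Chernoff's method: Markov's inequality for the exponential with parameter
  \<open>t\<close>, the value that makes the exponent \<open>t\<^sup>2 / 2 - t\<^sup>2\<close>
  smallest. For \<open>t = 0\<close> the bound is 1.\<close>

lemma signs_tail:
  assumes I: "finite I" and c: "(\<Sum>i\<in>I. (c i)\<^sup>2) \<le> 1" and t: "t \<ge> 0"
  shows "measure_pmf.prob (signs_pmf I) {f. (\<Sum>i\<in>I. c i * f i) \<ge> t} \<le> exp (- t\<^sup>2 / 2)"
proof (cases "t > 0")
  case False
  with t show ?thesis by simp
next
  case t: True
  have "measure_pmf.prob (signs_pmf I) {f. (\<Sum>i\<in>I. c i * f i) \<ge> t} =
      measure_pmf.prob (signs_pmf I) {f \<in> space (signs_pmf I). exp (\<Sum>i\<in>I. t * c i * f i) \<ge> exp (t\<^sup>2)}"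
    using t by (simp add: sum_distrib_left[symmetric] mult.assoc power2_eq_square)
  also have "\<dots> \<le> measure_pmf.expectation (signs_pmf I) (\<lambda>f. exp (\<Sum>i\<in>I. t * c i * f i)) / exp (t\<^sup>2)"
    by (intro integral_Markov_inequality_measure[where A = "{}"] integrable_measure_pmf_finite finite_set_signs_pmf I) auto
  also have "\<dots> \<le> exp ((\<Sum>i\<in>I. (t * c i)\<^sup>2) / 2) / exp (t\<^sup>2)"
    by (intro divide_right_mono signs_mgf_le I) auto
  also have "\<dots> \<le> exp (t\<^sup>2 / 2) / exp (t\<^sup>2)"
    using c by (intro divide_right_mono) (auto simp: power_mult_distrib sum_distrib_left[symmetric] mult_left_le)
  also have "\<dots> = exp (- t\<^sup>2 / 2)" by (simp add: exp_diff[symmetric])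
  finally show ?thesis .
qed

section \<open>Random sign matrices: fixed vectors, then whole subspaces\<close>

abbreviation sign_matrix :: "nat \<Rightarrow> (nat \<times> nat \<Rightarrow> real) pmf" where
  "sign_matrix n \<equiv> signs_pmf ({..<n} \<times> {..<n})"

text \<open>The coefficients \<open>x i * y j\<close> form a rank one array, whose sum of squares is
  the product of the two squared norms, hence at most 1.\<close>

lemma bilin_tail:
  assumes "norm2 n x \<le> 1" "norm2 n y \<le> 1" "t \<ge> 0"
  shows "measure_pmf.prob (sign_matrix n) {f. bilin n n f x y \<ge> t} \<le> exp (- t\<^sup>2 / 2)"
proof -
  have "(\<Sum>p\<in>{..<n} \<times> {..<n}. (x (fst p) * y (snd p))\<^sup>2) = (\<Sum>i<n. (x i)\<^sup>2) * (\<Sum>j<n. (y j)\<^sup>2)"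
    by (simp add: sum_product sum.cartesian_product case_prod_beta power_mult_distrib)
  also have "\<dots> \<le> 1 * 1"
    using assms by (intro mult_mono) (auto simp: L2_set_def sum_nonneg)
  finally have "measure_pmf.prob (sign_matrix n)
      {f. (\<Sum>p\<in>{..<n} \<times> {..<n}. x (fst p) * y (snd p) * f p) \<ge> t} \<le> exp (- t\<^sup>2 / 2)"
    using assms(3) by (intro signs_tail) auto
  moreover have "bilin n n f x y = (\<Sum>p\<in>{..<n} \<times> {..<n}. x (fst p) * y (snd p) * f p)" for f
    by (simp add: bilin_def sum.cartesian_product case_prod_beta mult_ac)
  ultimately show ?thesis by simp
qed

text \<open>Union bound over pairs of net points. If no pair reaches \<open>t\<close>, the net
  argument for the restricted form yields \<open>2 * t\<close>; the squared power bounds the number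
  of pairs.\<close>

lemma compressed_norm_tail:
  assumes r: "r \<ge> 1" "k \<le> r" "l \<le> r" and u: "orthonormal n k u" and v: "orthonormal n l v"
    and t: "t \<ge> 0"
  shows "measure_pmf.prob (sign_matrix n)
      {f. \<exists>x y. bilin n n f (comb k u x) (comb l v y) > 2 * t * norm2 k x * norm2 l y} \<le>
    ((2 ^ 16 * 3) ^ r)\<^sup>2 * exp (- t\<^sup>2 / 2)"
proof -
  let ?P = "measure_pmf.prob (sign_matrix n)" and ?N = "lattice_net k r \<times> lattice_net l r"
  let ?B = "\<lambda>p. {f. bilin n n f (comb k u (fst p)) (comb l v (snd p)) \<ge> t}"
  have "{f. \<exists>x y. bilin n n f (comb k u x) (comb l v y) > 2 * t * norm2 k x * norm2 l y} \<subseteq> (\<Union>p\<in>?N. ?B p)"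
  proof (rule subsetI, rule ccontr)
    fix f assume f: "f \<in> {f. \<exists>x y. bilin n n f (comb k u x) (comb l v y) > 2 * t * norm2 k x * norm2 l y}"
      and nf: "f \<notin> (\<Union>p\<in>?N. ?B p)"
    have "bilin k l (\<lambda>(a, b). bilin n n f (u a) (v b)) x y \<le> 2 * t * norm2 k x * norm2 l y" for x y
      using nf by (intro bilin_le_of_net[OF r]) (force simp: bilin_comb)
    then show False using f by (auto simp: bilin_comb not_less[symmetric])
  qed
  then have "?P {f. \<exists>x y. bilin n n f (comb k u x) (comb l v y) > 2 * t * norm2 k x * norm2 l y} \<le> ?P (\<Union>p\<in>?N. ?B p)"
    by (intro measure_pmf.finite_measure_mono) auto
  also have "\<dots> \<le> (\<Sum>p\<in>?N. ?P (?B p))"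
    by (intro measure_pmf.finite_measure_subadditive_finite) auto
  also have "\<dots> \<le> (\<Sum>p\<in>?N. exp (- t\<^sup>2 / 2))"
    using r u v t by (intro sum_mono bilin_tail) (auto simp: norm2_comb norm2_lattice_net)
  also have "\<dots> = real (card (lattice_net k r)) * real (card (lattice_net l r)) * exp (- t\<^sup>2 / 2)"
    by (simp add: card_cartesian_product)
  also have "\<dots> \<le> (2 ^ 16 * 3) ^ r * (2 ^ 16 * 3) ^ r * exp (- t\<^sup>2 / 2)"
    using card_lattice_net[OF r(2)] card_lattice_net[OF r(3)] by (intro mult_right_mono mult_mono) auto
  finally show ?thesis by (simp only: power2_eq_square[of "(2 ^ 16 * 3) ^ r"])
qed

section \<open>Orthonormal factorization\<close>

text \<open>Each new vector either lies in the span already built, and then adds nothing, or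
  contributes its normalized residual. Hence \<open>k\<close> may be smaller than \<open>m\<close>,
  and no independence is assumed.\<close>

lemma gram_schmidt:
  "\<exists>k e. k \<le> m \<and> orthonormal n k e \<and> (\<forall>i<m. \<exists>c. \<forall>p<n. w i p = comb k e c p)"
proof (induction m)
  case 0
  show ?case by (intro exI[of _ 0]) (simp add: orthonormal_def)
next
  case (Suc m)
  then obtain k e where k: "k \<le> m" and e: "orthonormal n k e"
    and span: "\<And>i. i < m \<Longrightarrow> \<exists>c. \<forall>p<n. w i p = comb k e c p" by blast
  \<comment> \<open>\<open>d\<close> holds the coordinates of the projection of \<open>w m\<close>
    onto the current span; \<open>q\<close> is the residual.\<close>
  define d where "d a = dotp n (w m) (e a)" for a
  define q where "q p = w m p - comb k e d p" for p
  have q_orth: "dotp n q (e b) = 0" if "b < k" for b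
    using that e by (simp add: q_def[abs_def] dotp_diff_left dotp_comb_orthonormal d_def)
  define s where "s = norm2 n q"
  show ?case
  proof (cases "s = 0")
    case True
    then have "\<forall>p<n. w m p = comb k e d p" by (simp add: s_def L2_set_eq_0_iff q_def)
    then show ?thesis using k e span by (intro exI[of _ k] exI[of _ e]) (auto simp: less_Suc_eq)
  next
    case False
    then have s: "s > 0" by (simp add: s_def less_le)
    define e' where "e' = e(k := \<lambda>p. inverse s * q p)"
    have "dotp n q q = s\<^sup>2" by (simp add: s_def norm2_power2)
    then have "dotp n (\<lambda>p. inverse s * q p) (\<lambda>p. inverse s * q p) = 1"
      unfolding dotp_scale_self using s by (simp add: power_inverse)
    moreover have "dotp n (\<lambda>p. inverse s * q p) (e b) = 0" "dotp n (e b) (\<lambda>p. inverse s * q p) = 0"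
      if "b < k" for b
      using q_orth[OF that] by (simp_all add: dotp_scale_left dotp_commute[of n "e b"])
    ultimately have e': "orthonormal n (Suc k) e'"
      using e by (auto simp: orthonormal_def e'_def less_Suc_eq)
    have comb': "comb (Suc k) e' (c(k := x)) p = comb k e c p + x * (inverse s * q p)" for c x p
      by (simp add: comb_def e'_def)
    have "\<exists>c. \<forall>p<n. w i p = comb (Suc k) e' c p" if "i < Suc m" for i
    proof (cases "i = m")
      case True
      have "w m p = comb (Suc k) e' (d(k := s)) p" for p
        unfolding comb' using s by (simp add: q_def field_simps)
      then show ?thesis using True by blast
    next
      case False
      then have "i < m" using that by simp
      then obtain c where "\<forall>p<n. w i p = comb k e c p" using span by blast
      then have "\<forall>p<n. w i p = comb (Suc k) e' (c(k := 0)) p" unfolding comb' by simp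
      then show ?thesis by blast
    qed
    then show ?thesis using k e' by (intro exI[of _ "Suc k"] exI[of _ e']) auto
  qed
qed

text \<open>A maximal linearly independent set of columns has as many elements as the rank, and by
  maximality spans every column. Enumerating it gives \<open>w\<close>.\<close>

lemma cols_span_rank:
  fixes A :: "real mat"
  assumes A: "A \<in> carrier_mat n nc"
  shows "\<exists>w c. \<forall>p<n. \<forall>j<nc. A $$ (p, j) = (\<Sum>t<vec_space.rank n A. c j t * w t p)"
proof -
  interpret vec_space "TYPE(real)" n .
  have carr: "set (cols A) \<subseteq> carrier_vec n" using cols_dim A by blast
  obtain S where S: "finite S" "maximal S (\<lambda>T. T \<subseteq> set (cols A) \<and> lin_indpt T)"
    using maximal_exists_superset[of "set (cols A)" "\<lambda>T. T \<subseteq> set (cols A) \<and> lin_indpt T" "{}"]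
    by (auto simp: lin_dep_def)
  have Ssub: "S \<subseteq> set (cols A)" and Sli: "lin_indpt S" using S(2) by (auto simp: maximal_def)
  have rank: "rank A = card S" by (rule rank_card_indpt[OF A S(2)])
  have in_span: "x \<in> span S" if "x \<in> set (cols A)" for x
  proof (rule ccontr)
    assume x: "x \<notin> span S"
    then have "x \<notin> S" using Ssub carr span_mem[of S x] by auto
    have "lin_indpt (insert x S)"
      using lin_dep_iff_in_span[of S x] x Ssub carr Sli that \<open>x \<notin> S\<close> by auto
    then show False using S(2) that Ssub \<open>x \<notin> S\<close> unfolding maximal_def by blast
  qed
  obtain g where g: "bij_betw g {..<card S} S"
    using ex_bij_betw_nat_finite[OF S(1)] by (auto simp: atLeast0LessThan)
  have "\<exists>c. \<forall>p<n. A $$ (p, j) = (\<Sum>t<rank A. c t * g t $ p)" if j: "j < nc" for j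
  proof -
    have "col A j \<in> set (cols A)" using j A by (auto simp: cols_def)
    then obtain a where a: "col A j = lincomb a S"
      using in_span finite_span[OF S(1)] Ssub carr by force
    have "A $$ (p, j) = (\<Sum>t<rank A. a (g t) * g t $ p)" if p: "p < n" for p
    proof -
      have "A $$ (p, j) = lincomb a S $ p" using a[symmetric] p j A by simp
      also have "\<dots> = (\<Sum>x\<in>S. a x * x $ p)" using p Ssub carr by (intro lincomb_index) auto
      also have "\<dots> = (\<Sum>t<rank A. a (g t) * g t $ p)"
        unfolding rank by (rule sum.reindex_bij_betw[OF g, symmetric])
      finally show ?thesis .
    qed
    then show ?thesis by (intro exI[of _ "\<lambda>t. a (g t)"]) blast
  qed
  then obtain c where "\<And>j p. j < nc \<Longrightarrow> p < n \<Longrightarrow> A $$ (p, j) = (\<Sum>t<rank A. c j t * g t $ p)"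
    by metis
  then show ?thesis by (intro exI[of _ "\<lambda>t p. g t $ p"] exI[of _ c] allI impI)
qed

text \<open>A factorization of \<open>A\<close> with orthonormal outer factors and a
  \<open>k\<close> by \<open>l\<close> core \<open>m\<close>, stated for forms: \<open>A\<close>
  sees \<open>x\<close> and \<open>y\<close> only through their coordinates along \<open>u\<close>
  and \<open>v\<close>.\<close>

lemma rank_orthonormal_factorization:
  fixes A :: "real mat"
  assumes A: "A \<in> carrier_mat n n" and r: "vec_space.rank n A = r"
  obtains k l u v m where "k \<le> r" "l \<le> r" "orthonormal n k u" "orthonormal n l v"
    "\<And>x y. bilin n n (($$) A) x y = bilin k l m (\<lambda>a. dotp n (u a) x) (\<lambda>b. dotp n (v b) y)"
proof -
  obtain w c where A_eq: "\<And>p j. p < n \<Longrightarrow> j < n \<Longrightarrow> A $$ (p, j) = (\<Sum>t<r. c j t * w t p)"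
    using cols_span_rank[OF A] r by blast
  obtain k u where k: "k \<le> r" and u: "orthonormal n k u"
    and "\<forall>t<r. \<exists>c. \<forall>p<n. w t p = comb k u c p"
    using gram_schmidt[of r n w] by blast
  then obtain d where d: "\<And>t p. t < r \<Longrightarrow> p < n \<Longrightarrow> w t p = comb k u (d t) p" by metis
  \<comment> \<open>\<open>b a\<close> is the coefficient row belonging to \<open>u a\<close>, so
    \<open>A\<close> is the sum of the products of \<open>u a\<close> with \<open>b a\<close>.
    Orthonormalizing these \<open>k\<close> rows yields \<open>v\<close>, whence
    \<open>l \<le> k\<close>.\<close>
  define b where "b a j = (\<Sum>t<r. c j t * d t a)" for a j
  obtain l v where l: "l \<le> k" and v: "orthonormal n l v"
    and "\<forall>a<k. \<exists>c. \<forall>j<n. b a j = comb l v c j"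
    using gram_schmidt[of k n b] by blast
  then obtain h where h: "\<And>a j. a < k \<Longrightarrow> j < n \<Longrightarrow> b a j = comb l v (h a) j" by metis
  have A_eq2: "A $$ (p, j) = (\<Sum>a<k. u a p * comb l v (h a) j)" if "p < n" "j < n" for p j
  proof -
    have "A $$ (p, j) = (\<Sum>t<r. \<Sum>a<k. u a p * (c j t * d t a))"
      using that by (simp add: A_eq d comb_def sum_distrib_left mult_ac)
    also have "\<dots> = (\<Sum>a<k. u a p * b a j)"
      by (subst sum.swap) (simp add: b_def sum_distrib_left)
    also have "\<dots> = (\<Sum>a<k. u a p * comb l v (h a) j)" using that by (simp add: h)
    finally show ?thesis .
  qed
  have "bilin n n (($$) A) x y = bilin k l (\<lambda>(a, b). h a b) (\<lambda>a. dotp n (u a) x) (\<lambda>b. dotp n (v b) y)" for x y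
  proof -
    have "bilin n n (($$) A) x y = (\<Sum>p<n. \<Sum>j<n. \<Sum>a<k. (u a p * x p) * (comb l v (h a) j * y j))"
      unfolding bilin_def by (intro sum.cong refl) (simp add: A_eq2 sum_distrib_left sum_distrib_right mult_ac)
    also have "\<dots> = (\<Sum>p<n. \<Sum>a<k. \<Sum>j<n. (u a p * x p) * (comb l v (h a) j * y j))"
      by (intro sum.cong refl sum.swap)
    also have "\<dots> = (\<Sum>a<k. \<Sum>p<n. \<Sum>j<n. (u a p * x p) * (comb l v (h a) j * y j))"
      by (rule sum.swap)
    also have "\<dots> = (\<Sum>a<k. dotp n (u a) x * dotp n (comb l v (h a)) y)"
      by (simp add: dotp_def sum_product)
    also have "\<dots> = bilin k l (\<lambda>(a, b). h a b) (\<lambda>a. dotp n (u a) x) (\<lambda>b. dotp n (v b) y)"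
      by (simp add: dotp_comb_left bilin_def sum_distrib_left mult_ac)
    finally show ?thesis .
  qed
  then show ?thesis using that k l u v by (meson le_trans)
qed

section \<open>The largest singular value\<close>

definition mat_app :: "nat \<Rightarrow> (nat \<times> nat \<Rightarrow> real) \<Rightarrow> (nat \<Rightarrow> real) \<Rightarrow> nat \<Rightarrow> real" where
  "mat_app n f x i = (\<Sum>j<n. f (i, j) * x j)"

lemma mat_app_add_scale: "mat_app n f (\<lambda>i. x i + t * y i) p = mat_app n f x p + t * mat_app n f y p"
  by (simp add: mat_app_def distrib_left sum.distrib sum_distrib_left mult_ac)

lemma dotp_add_scale:
  "dotp n (\<lambda>i. x i + t * y i) (\<lambda>i. x i + t * y i) = dotp n x x + 2 * t * dotp n x y + t\<^sup>2 * dotp n y y"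
  by (simp add: dotp_def sum.distrib sum_distrib_left algebra_simps power2_eq_square)

lemma dotp_nonneg: "dotp n x x \<ge> 0"
  by (simp add: dotp_def sum_nonneg)

text \<open>A continuous function attains its maximum on the compact unit sphere; scaling extends
  the inequality to all vectors.\<close>

lemma mat_app_maximizer:
  assumes n: "n \<ge> 1"
  obtains v where "dotp n v v = 1"
    "\<And>x. dotp n (mat_app n f x) (mat_app n f x) \<le> dotp n (mat_app n f v) (mat_app n f v) * dotp n x x"
proof -
  let ?Q = "\<lambda>x. dotp n (mat_app n f x) (mat_app n f x)"
  \<comment> \<open>Coordinates from \<open>n\<close> on are pinned to 0, so \<open>B\<close> is a
    product of compact sets and thus compact by Tychonoff's theorem.\<close>
  define B :: "(nat \<Rightarrow> real) set" where "B = PiE UNIV (\<lambda>i. if i < n then {-1..1} else {0})"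
  define K where "K = B \<inter> {x. dotp n x x = 1}"
  have "compactin euclidean B"
    unfolding euclidean_product_topology[symmetric] B_def compactin_PiE by simp
  then have "compact B" by simp
  moreover have "closed {x. dotp n x x = 1}"
    unfolding dotp_def by (intro closed_Collect_eq continuous_intros continuous_on_product_coordinates)
  ultimately have K: "compact K" unfolding K_def by (rule compact_Int_closed)
  have cont: "continuous_on K ?Q"
    unfolding dotp_def mat_app_def
    by (intro continuous_intros continuous_on_subset[OF continuous_on_product_coordinates]) auto
  have "(\<lambda>i. if i = 0 then 1 else 0) \<in> K"
    using n by (auto simp: K_def B_def dotp_def if_distrib if_distribR cong: if_cong)
  then obtain v where v: "v \<in> K" "\<And>x. x \<in> K \<Longrightarrow> ?Q x \<le> ?Q v"
    using continuous_attains_sup[OF K _ cont] by blast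
  have "?Q x \<le> ?Q v * dotp n x x" for x
  proof (cases "dotp n x x = 0")
    case True
    then have "mat_app n f x p = 0" for p
      unfolding mat_app_def by (intro sum.neutral) (auto dest: dotp_self_eq_0D)
    then show ?thesis using True by (simp add: dotp_def)
  next
    case False
    define s where "s = norm2 n x"
    have ss: "s\<^sup>2 = dotp n x x" by (simp add: s_def norm2_power2)
    have s: "s > 0" using False dotp_nonneg[of n x] unfolding s_def norm2_eq_sqrt by simp
    define x' where "x' i = (if i < n then inverse s * x i else 0)" for i
    have "dotp n x' x' = dotp n (\<lambda>i. inverse s * x i) (\<lambda>i. inverse s * x i)"
      by (rule dotp_cong) (auto simp: x'_def)
    also have "\<dots> = (inverse s)\<^sup>2 * s\<^sup>2" unfolding ss by (rule dotp_scale_self)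
    finally have one: "dotp n x' x' = 1" using s by (simp add: power_inverse)
    have "x' i \<in> {-1..1}" if "i < n" for i
    proof -
      have "(x' i)\<^sup>2 \<le> dotp n x' x'"
        using that unfolding dotp_def power2_eq_square by (intro member_le_sum) auto
      then show ?thesis using one by (simp add: abs_square_le_1 abs_le_iff)
    qed
    then have "x' \<in> K" using one by (auto simp: K_def B_def x'_def)
    then have "?Q x' \<le> ?Q v" by (rule v(2))
    moreover have "mat_app n f x' = (\<lambda>p. inverse s * mat_app n f x p)"
      by (auto simp: mat_app_def x'_def sum_distrib_left mult_ac intro!: ext sum.cong)
    then have "?Q x' = ?Q x / s\<^sup>2"
      by (simp only: dotp_scale_self power_inverse divide_inverse mult.commute)
    ultimately show ?thesis using s unfolding ss[symmetric] by (simp add: divide_le_eq)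
  qed
  then show ?thesis using that v(1) by (auto simp: K_def)
qed

text \<open>At \<open>t = - b / (c + 1)\<close> the expression equals \<open>- t\<^sup>2\<close>.
  The added 1 keeps the denominator positive when \<open>c = 0\<close>.\<close>

lemma linear_coeff_zero:
  fixes b c :: real
  assumes "\<And>t. t * b + t\<^sup>2 * c \<ge> 0" "c \<ge> 0"
  shows "b = 0"
proof -
  define t where "t = - b / (c + 1)"
  have b: "b = - t * (c + 1)" using assms(2) by (simp add: t_def)
  have "t * b + t\<^sup>2 * c = - t\<^sup>2" by (simp add: b algebra_simps power2_eq_square)
  then have "t = 0" using assms(1)[of t] by simp
  then show ?thesis using b by simp
qed

lemma mat_app_transpose: "dotp n (mat_app n f x) y = dotp n x (mat_app n (f \<circ> prod.swap) y)"
  unfolding dotp_def mat_app_def sum_distrib_left sum_distrib_right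
  by (subst sum.swap) (simp add: mult_ac)

text \<open>The form \<open>m |x|\<^sup>2 - |f x|\<^sup>2\<close> is nonnegative and vanishes at \<open>v\<close>, so \<open>v\<close> lies in its radical.\<close>
lemma maximizer_eigenvector:
  assumes v: "dotp n v v = 1"
    and max: "\<And>x. dotp n (mat_app n f x) (mat_app n f x) \<le> m * dotp n x x"
    and m: "m = dotp n (mat_app n f v) (mat_app n f v)"
    and i: "i < n"
  shows "mat_app n (f \<circ> prod.swap) (mat_app n f v) i = m * v i"
proof -
  define g where "g = mat_app n (f \<circ> prod.swap) (mat_app n f v)"
  \<comment> \<open>The defect in the eigenvector equation is itself the test direction: moving from
    \<open>v\<close> along \<open>x\<close>, the form has linear coefficient
    \<open>2 * dotp n x x\<close>, which must vanish.\<close>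
  define x where "x i = m * v i - g i" for i
  let ?c = "m * dotp n x x - dotp n (mat_app n f x) (mat_app n f x)"
  have "dotp n (mat_app n f v) (mat_app n f x) = dotp n g x"
    using mat_app_transpose[of n f x "mat_app n f v"] by (simp add: g_def dotp_commute)
  then have b: "m * dotp n v x - dotp n (mat_app n f v) (mat_app n f x) = dotp n x x"
    unfolding x_def[abs_def] dotp_diff_left dotp_scale_left by simp
  have "t * (2 * dotp n x x) + t\<^sup>2 * ?c \<ge> 0" for t
  proof -
    have "dotp n (mat_app n f (\<lambda>i. v i + t * x i)) (mat_app n f (\<lambda>i. v i + t * x i)) =
      m + 2 * t * dotp n (mat_app n f v) (mat_app n f x) + t\<^sup>2 * dotp n (mat_app n f x) (mat_app n f x)"
      unfolding mat_app_add_scale dotp_add_scale m by simp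
    moreover have "m * dotp n (\<lambda>i. v i + t * x i) (\<lambda>i. v i + t * x i) =
      m + 2 * t * (m * dotp n v x) + t\<^sup>2 * (m * dotp n x x)"
      unfolding dotp_add_scale v by (simp add: algebra_simps)
    ultimately show ?thesis
      using max[of "\<lambda>i. v i + t * x i"] unfolding b[symmetric] by (simp add: algebra_simps)
  qed
  then have "2 * dotp n x x = 0" using max[of x] by (intro linear_coeff_zero[of _ ?c]) auto
  then have "x i = 0" using i by (intro dotp_self_eq_0D) auto
  then show ?thesis by (simp add: x_def g_def)
qed

section \<open>Gram matrices and the variational form of the largest singular value\<close>

lemma mult_mat_vec_mat_app:
  assumes "A \<in> carrier_mat n n" "x \<in> carrier_vec n" "i < n"
  shows "(A *\<^sub>v x) $ i = mat_app n (($$) A) (($) x) i"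
  using assms by (simp add: mat_app_def scalar_prod_def atLeast0LessThan)

lemma gram_mult_vec:
  fixes A :: "real mat"
  assumes A: "A \<in> carrier_mat n n" and x: "x \<in> carrier_vec n" and i: "i < n"
  shows "((transpose_mat A * A) *\<^sub>v x) $ i =
    mat_app n (($$) A \<circ> prod.swap) (mat_app n (($$) A) (($) x)) i"
proof -
  have T: "transpose_mat A \<in> carrier_mat n n" using A by simp
  have "((transpose_mat A * A) *\<^sub>v x) $ i = (transpose_mat A *\<^sub>v (A *\<^sub>v x)) $ i"
    using assoc_mult_mat_vec[OF T A x] by simp
  also have "\<dots> = mat_app n (($$) (transpose_mat A)) (($) (A *\<^sub>v x)) i"
    using A x i by (intro mult_mat_vec_mat_app) auto
  also have "\<dots> = (\<Sum>j<n. A $$ (j, i) * mat_app n (($$) A) (($) x) j)"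
    unfolding mat_app_def[of n "($$) (transpose_mat A)"]
    using A i mult_mat_vec_mat_app[OF A x] by (intro sum.cong) auto
  finally show ?thesis by (simp add: mat_app_def[of n "($$) A \<circ> prod.swap"])
qed

text \<open>The maximizer makes \<open>m\<close> an eigenvalue of the Gram matrix. An eigenvector
  \<open>x\<close> for any other eigenvalue \<open>c\<close> has squared image norm
  \<open>c * dotp n x x\<close>, so \<open>c \<le> m\<close>. Finiteness of the spectrum comes from
  the characteristic polynomial.\<close>

lemma largest_singular_value_maximizer:
  assumes A: "A \<in> carrier_mat n n"
    and v: "dotp n v v = 1"
    and max: "\<And>x. dotp n (mat_app n (($$) A) x) (mat_app n (($$) A) x) \<le> m * dotp n x x"
    and m: "m = dotp n (mat_app n (($$) A) v) (mat_app n (($$) A) v)"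
  shows "largest_singular_value A = sqrt m"
proof -
  define G where "G = transpose_mat A * A"
  have G: "G \<in> carrier_mat n n" using A by (simp add: G_def)
  have "{x. eigenvalue G x} = {x. poly (char_poly G) x = 0}"
    using eigenvalue_root_char_poly[OF G] by simp
  moreover have "char_poly G \<noteq> 0" using degree_monic_char_poly[OF G] by auto
  ultimately have fin: "finite {x. eigenvalue G x}" using poly_roots_finite by metis
  have "Matrix.vec n v \<noteq> 0\<^sub>v n"
  proof
    assume "Matrix.vec n v = 0\<^sub>v n"
    then have "v i = 0" if "i < n" for i using that by (metis index_vec index_zero_vec(1))
    then show False using v by (simp add: dotp_def)
  qed
  moreover have "G *\<^sub>v Matrix.vec n v = m \<cdot>\<^sub>v Matrix.vec n v"
  proof (rule eq_vecI)
    fix i assume "i < dim_vec (m \<cdot>\<^sub>v Matrix.vec n v)"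
    then have i: "i < n" by simp
    have "mat_app n (($$) A) (($) (Matrix.vec n v)) = mat_app n (($$) A) v"
      by (auto simp: mat_app_def)
    then show "(G *\<^sub>v Matrix.vec n v) $ i = (m \<cdot>\<^sub>v Matrix.vec n v) $ i"
      using gram_mult_vec[OF A _ i, of "Matrix.vec n v"] maximizer_eigenvector[OF v max m i] i
      by (simp add: G_def)
  qed (use G in simp)
  ultimately have "eigenvector G (Matrix.vec n v) m" using G by (simp add: eigenvector_def)
  then have em: "eigenvalue G m" by (auto simp: eigenvalue_def)
  have le: "c \<le> m" if eig: "eigenvalue G c" for c
  proof -
    obtain x where x: "x \<in> carrier_vec n" "x \<noteq> 0\<^sub>v n" "G *\<^sub>v x = c \<cdot>\<^sub>v x"
      using eig G unfolding eigenvalue_def eigenvector_def by auto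
    let ?x = "($) x"
    have "dotp n ?x ?x \<noteq> 0"
    proof
      assume "dotp n ?x ?x = 0"
      then have "x = 0\<^sub>v n" using x(1) by (intro eq_vecI) (auto dest: dotp_self_eq_0D)
      then show False using x by simp
    qed
    then have pos: "dotp n ?x ?x > 0" using dotp_nonneg[of n ?x] by linarith
    have "dotp n (mat_app n (($$) A) ?x) (mat_app n (($$) A) ?x) =
        dotp n ?x (mat_app n (($$) A \<circ> prod.swap) (mat_app n (($$) A) ?x))"
      by (rule mat_app_transpose)
    also have "\<dots> = dotp n ?x (\<lambda>i. c * ?x i)"
    proof (rule dotp_cong)
      fix i assume "i < n"
      then show "mat_app n (($$) A \<circ> prod.swap) (mat_app n (($$) A) ?x) i = c * ?x i"
        using gram_mult_vec[OF A x(1)] x unfolding G_def[symmetric] by simp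
    qed simp
    also have "\<dots> = c * dotp n ?x ?x" by (rule dotp_scale_right)
    finally have "c * dotp n ?x ?x \<le> m * dotp n ?x ?x" using max[of ?x] by simp
    then show ?thesis using pos by simp
  qed
  show ?thesis
    unfolding largest_singular_value_def singular_values_def G_def[symmetric]
    using fin em le by (intro Max_eqI) auto
qed

lemma bilin_mat_app: "bilin n n f x y = dotp n x (mat_app n f y)"
  by (simp add: bilin_dotp_right mat_app_def[abs_def])

text \<open>The bound is Cauchy-Schwarz. Equality holds for the maximizer \<open>v\<close> paired
  with its normalized image, or with itself when the image is zero.\<close>

lemma largest_singular_value_bilin:
  assumes n: "n \<ge> 1" and A: "A \<in> carrier_mat n n"
  shows bilin_le_largest_singular_value:
      "\<And>x y. bilin n n (($$) A) x y \<le> largest_singular_value A * norm2 n x * norm2 n y"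
    and largest_singular_value_attained:
      "\<exists>x y. norm2 n x = 1 \<and> norm2 n y = 1 \<and> bilin n n (($$) A) x y = largest_singular_value A"
proof -
  let ?f = "($$) A"
  obtain v where v: "dotp n v v = 1"
    and max: "\<And>x. dotp n (mat_app n ?f x) (mat_app n ?f x) \<le>
      dotp n (mat_app n ?f v) (mat_app n ?f v) * dotp n x x"
    using mat_app_maximizer[OF n] by metis
  define s where "s = norm2 n (mat_app n ?f v)"
  have s: "s \<ge> 0" by (simp add: s_def)
  have lsv: "largest_singular_value A = s"
    unfolding s_def norm2_eq_sqrt by (rule largest_singular_value_maximizer[OF A v max refl])
  have v1: "norm2 n v = 1" unfolding norm2_eq_sqrt v by simp
  show "bilin n n ?f x y \<le> largest_singular_value A * norm2 n x * norm2 n y" for x y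
  proof -
    have "(norm2 n (mat_app n ?f y))\<^sup>2 \<le> (s * norm2 n y)\<^sup>2"
      using max[of y] by (simp add: power_mult_distrib norm2_power2 s_def)
    then have "norm2 n (mat_app n ?f y) \<le> s * norm2 n y"
      by (rule power2_le_imp_le) (simp add: s)
    then have "norm2 n x * norm2 n (mat_app n ?f y) \<le> norm2 n x * (s * norm2 n y)"
      by (intro mult_left_mono) auto
    then show ?thesis
      using dotp_le_norm2[of n x "mat_app n ?f y"] by (simp add: bilin_mat_app lsv mult_ac)
  qed
  show "\<exists>x y. norm2 n x = 1 \<and> norm2 n y = 1 \<and> bilin n n ?f x y = largest_singular_value A"
  proof (cases "s = 0")
    case True
    then have "bilin n n ?f v v = 0"
      unfolding bilin_mat_app dotp_def s_def
      by (intro sum.neutral) (auto simp: L2_set_eq_0_iff)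
    then show ?thesis using v1 True lsv by auto
  next
    case False
    define x where "x i = inverse s * mat_app n ?f v i" for i
    have "norm2 n x = 1" using False s by (simp add: x_def[abs_def] norm2_scale flip: s_def)
    moreover have "bilin n n ?f x v = s"
      using False unfolding bilin_mat_app x_def[abs_def] dotp_scale_left norm2_power2[symmetric] s_def[symmetric]
      by (simp add: power2_eq_square)
    ultimately show ?thesis using v1 lsv by (intro exI[of _ x] exI[of _ v] conjI) auto
  qed
qed

section \<open>The perturbation bound\<close>

text \<open>\<open>x\<^sub>1\<close> is the orthogonal projection onto the span of \<open>u\<close>,
  so the norm identity is Pythagoras. The last clause lets a form that reads only coordinates along
  \<open>u\<close> replace \<open>x\<close> by \<open>x\<^sub>1\<close>.\<close>

lemma projection_decomposition:
  assumes u: "orthonormal n k u" and x: "norm2 n x = 1"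
  obtains x\<^sub>1 x\<^sub>2 where "x\<^sub>1 = comb k u (\<lambda>a. dotp n (u a) x)" "\<And>i. x i = x\<^sub>1 i + x\<^sub>2 i"
    "(norm2 n x\<^sub>1)\<^sup>2 + (norm2 n x\<^sub>2)\<^sup>2 = 1" "\<And>a. a < k \<Longrightarrow> dotp n (u a) x\<^sub>1 = dotp n (u a) x"
proof -
  define x\<^sub>1 where "x\<^sub>1 = comb k u (\<lambda>a. dotp n (u a) x)"
  define x\<^sub>2 where "x\<^sub>2 i = x i - x\<^sub>1 i" for i
  have proj: "dotp n (u a) x\<^sub>1 = dotp n (u a) x" if "a < k" for a
    using dotp_comb_orthonormal[OF u that] by (simp add: x\<^sub>1_def dotp_commute)
  have "dotp n x\<^sub>1 x\<^sub>1 = dotp n x\<^sub>1 x"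
    using proj by (simp add: x\<^sub>1_def dotp_comb_left[of n k u "\<lambda>a. dotp n (u a) x"])
  moreover have "dotp n x x = 1" unfolding norm2_power2[symmetric] x by simp
  moreover have "dotp n x\<^sub>2 x\<^sub>2 = dotp n x x - 2 * dotp n x\<^sub>1 x + dotp n x\<^sub>1 x\<^sub>1"
    by (simp add: x\<^sub>2_def[abs_def] dotp_def sum_subtractf sum.distrib sum_distrib_left algebra_simps)
  ultimately have "(norm2 n x\<^sub>1)\<^sup>2 + (norm2 n x\<^sub>2)\<^sup>2 = 1" by (simp only: norm2_power2)
  then show ?thesis using that[OF x\<^sub>1_def, of x\<^sub>2] proj by (simp add: x\<^sub>2_def)
qed

text \<open>Since \<open>a * b \<le> 1 - (p\<^sup>2 + q\<^sup>2) / 2\<close>, the main term loses at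
  least \<open>N\<^sup>2 * (p\<^sup>2 + q\<^sup>2) / 2\<close>, which absorbs the linear cross
  terms. In the application \<open>N = sqrt n\<close>.\<close>

lemma upper_bound_arith:
  fixes s a b p q C N :: real
  assumes "a\<^sup>2 + p\<^sup>2 = 1" "b\<^sup>2 + q\<^sup>2 = 1" "a \<ge> 0" "b \<ge> 0" "p \<ge> 0" "q \<ge> 0"
    and "s \<ge> N\<^sup>2" "N \<ge> 0" "C \<ge> 0"
  shows "s * (a * b) + C * N * (p * b + a * q + p * q) \<le> s + 5 * C\<^sup>2 / 2"
proof -
  have "a\<^sup>2 \<le> 1\<^sup>2" "b\<^sup>2 \<le> 1\<^sup>2" "p\<^sup>2 \<le> 1\<^sup>2"
    using assms(1,2) zero_le_power2[of a] zero_le_power2[of p] zero_le_power2[of q]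
    unfolding one_power2 by linarith+
  then have le1: "a \<le> 1" "b \<le> 1" "p \<le> 1" by (auto intro: power2_le_imp_le)
  have "2 * (a * b) \<le> a\<^sup>2 + b\<^sup>2" using sum_squares_bound[of a b] by simp
  then have ab: "a * b \<le> 1 - (p\<^sup>2 + q\<^sup>2) / 2" using assms(1,2) by (simp add: field_simps)
  have "s \<ge> 0" using assms(7) zero_le_power2[of N] by linarith
  then have "s * (a * b) \<le> s * (1 - (p\<^sup>2 + q\<^sup>2) / 2)" using ab by (rule mult_left_mono[rotated])
  also have "\<dots> = s - s * ((p\<^sup>2 + q\<^sup>2) / 2)" by (simp add: algebra_simps)
  also have "\<dots> \<le> s - N\<^sup>2 * ((p\<^sup>2 + q\<^sup>2) / 2)" using assms(7) by (simp add: mult_right_mono)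
  finally have 1: "s * (a * b) \<le> s - N\<^sup>2 * ((p\<^sup>2 + q\<^sup>2) / 2)" .
  have "p * b \<le> p" "a * q \<le> q" "p * q \<le> q"
    using le1 assms(3-6) by (auto simp: mult_left_le mult_left_le_one_le)
  then have "C * N * (p * b + a * q + p * q) \<le> C * N * (p + 2 * q)"
    using assms by (intro mult_left_mono) auto
  \<comment> \<open>Completing the squares in \<open>N * p\<close> and \<open>N * q\<close> leaves
    \<open>(C\<^sup>2 + (2 * C)\<^sup>2) / 2\<close>.\<close>
  also have "\<dots> = N\<^sup>2 * ((p\<^sup>2 + q\<^sup>2) / 2) + 5 * C\<^sup>2 / 2 - ((N * p - C)\<^sup>2 + (N * q - 2 * C)\<^sup>2) / 2"
    by (simp add: power2_eq_square field_simps)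
  also have "\<dots> \<le> N\<^sup>2 * ((p\<^sup>2 + q\<^sup>2) / 2) + 5 * C\<^sup>2 / 2" by simp
  finally show ?thesis using 1 by linarith
qed

text \<open>The deterministic half of the upper bound. At a top pair of the perturbed matrix,
  \<open>D\<close> controls the perturbation on the two projections and \<open>C * sqrt n\<close>
  each of the three remaining terms.\<close>

lemma perturbed_singular_value_upper:
  fixes A :: "real mat" and f :: "nat \<times> nat \<Rightarrow> real"
  assumes n: "n \<ge> 1" and A: "A \<in> carrier_mat n n" and s: "largest_singular_value A \<ge> real n"
    and u: "orthonormal n k u" and v: "orthonormal n l v"
    and fact: "\<And>x y. bilin n n (($$) A) x y = bilin k l m (\<lambda>a. dotp n (u a) x) (\<lambda>b. dotp n (v b) y)"
    and f: "\<And>x y. bilin n n f x y \<le> C * sqrt n * norm2 n x * norm2 n y"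
    and fuv: "\<And>x y. bilin n n f (comb k u x) (comb l v y) \<le> D * norm2 k x * norm2 l y"
    and CD: "C \<ge> 0" "D \<ge> 0"
  shows "largest_singular_value (A + Matrix.mat n n f) \<le> largest_singular_value A + D + 5 * C\<^sup>2 / 2"
proof -
  define s where "s = largest_singular_value A"
  let ?A' = "A + Matrix.mat n n f"
  have A': "?A' \<in> carrier_mat n n" using A by simp
  obtain x y where x: "norm2 n x = 1" and y: "norm2 n y = 1"
    and s': "bilin n n (($$) ?A') x y = largest_singular_value ?A'"
    using largest_singular_value_attained[OF n A'] by blast
  obtain x\<^sub>1 x\<^sub>2 where x12: "x\<^sub>1 = comb k u (\<lambda>a. dotp n (u a) x)" "\<And>i. x i = x\<^sub>1 i + x\<^sub>2 i"
    "(norm2 n x\<^sub>1)\<^sup>2 + (norm2 n x\<^sub>2)\<^sup>2 = 1" "\<And>a. a < k \<Longrightarrow> dotp n (u a) x\<^sub>1 = dotp n (u a) x"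
    using projection_decomposition[OF u x] by metis
  obtain y\<^sub>1 y\<^sub>2 where y12: "y\<^sub>1 = comb l v (\<lambda>a. dotp n (v a) y)" "\<And>i. y i = y\<^sub>1 i + y\<^sub>2 i"
    "(norm2 n y\<^sub>1)\<^sup>2 + (norm2 n y\<^sub>2)\<^sup>2 = 1" "\<And>a. a < l \<Longrightarrow> dotp n (v a) y\<^sub>1 = dotp n (v a) y"
    using projection_decomposition[OF v y] by metis
  define a b p q where "a = norm2 n x\<^sub>1" and "b = norm2 n y\<^sub>1" and "p = norm2 n x\<^sub>2" and "q = norm2 n y\<^sub>2"
  have sq: "a\<^sup>2 + p\<^sup>2 = 1" "b\<^sup>2 + q\<^sup>2 = 1" using x12(3) y12(3) by (simp_all add: a_def b_def p_def q_def)
  have nn: "a \<ge> 0" "b \<ge> 0" "p \<ge> 0" "q \<ge> 0" by (simp_all add: a_def b_def p_def q_def)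
  have "a\<^sup>2 \<le> 1\<^sup>2" "b\<^sup>2 \<le> 1\<^sup>2" using sq zero_le_power2[of p] zero_le_power2[of q] unfolding one_power2 by linarith+
  then have ab1: "a \<le> 1" "b \<le> 1" by (auto intro: power2_le_imp_le)
  have "largest_singular_value ?A' = bilin n n (($$) A) x y + bilin n n f x y"
    unfolding s'[symmetric] bilin_add_fun[symmetric] using A by (intro bilin_cong) auto
  also have "bilin n n (($$) A) x y = bilin n n (($$) A) x\<^sub>1 y\<^sub>1"
    unfolding fact using x12(4) y12(4) by (intro bilin_cong) auto
  also have "\<dots> \<le> s * a * b"
    unfolding s_def a_def b_def by (rule bilin_le_largest_singular_value[OF n A])
  also have "bilin n n f x y = bilin n n f x\<^sub>1 y\<^sub>1 + bilin n n f x\<^sub>1 y\<^sub>2 + bilin n n f x\<^sub>2 y\<^sub>1 + bilin n n f x\<^sub>2 y\<^sub>2"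
  proof -
    have "x = (\<lambda>i. x\<^sub>1 i + x\<^sub>2 i)" "y = (\<lambda>i. y\<^sub>1 i + y\<^sub>2 i)" using x12(2) y12(2) by auto
    then show ?thesis by (simp add: bilin_add_left bilin_add_right)
  qed
  also have "\<dots> \<le> D + C * sqrt n * a * q + C * sqrt n * p * b + C * sqrt n * p * q"
  proof (intro add_mono)
    have "bilin n n f x\<^sub>1 y\<^sub>1 \<le> D * norm2 k (\<lambda>a. dotp n (u a) x) * norm2 l (\<lambda>a. dotp n (v a) y)"
      unfolding x12(1) y12(1) by (rule fuv)
    also have "\<dots> = D * (a * b)"
      using norm2_comb[OF u] norm2_comb[OF v] by (simp add: a_def b_def x12(1) y12(1))
    also have "\<dots> \<le> D" using ab1 nn CD by (simp add: mult_left_le mult_le_one)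
    finally show "bilin n n f x\<^sub>1 y\<^sub>1 \<le> D" .
  qed (use f in \<open>simp_all add: a_def b_def p_def q_def\<close>)
  finally have "largest_singular_value ?A' \<le> D + (s * (a * b) + C * sqrt n * (p * b + a * q + p * q))"
    by (simp add: algebra_simps)
  also have "s * (a * b) + C * sqrt n * (p * b + a * q + p * q) \<le> s + 5 * C\<^sup>2 / 2"
    using s CD nn by (intro upper_bound_arith sq) (auto simp: s_def)
  finally show ?thesis by (simp add: s_def)
qed

text \<open>\<open>c\<close> is chosen so that \<open>exp (- c\<^sup>2 / 2) = \<theta> / Q\<close>.
  The Gaussian factor then beats the net size \<open>Q ^ r\<close> for all \<open>r\<close> at once
  and leaves \<open>\<theta> ^ r\<close>.\<close>

lemma tail_constant:
  fixes \<eta> :: real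
  assumes "\<eta> > 0"
  obtains c where "c \<ge> 0" "exp (- c\<^sup>2 / 2) \<le> \<eta>"
    "\<And>r. r \<ge> 1 \<Longrightarrow> ((2 ^ 16 * 3) ^ r)\<^sup>2 * exp (- (c * sqrt (real r))\<^sup>2 / 2) \<le> \<eta>"
proof -
  define Q :: real where "Q = (2 ^ 16 * 3)\<^sup>2"
  \<comment> \<open>Capping at 1 gives \<open>\<theta> ^ r \<le> \<theta>\<close> and keeps the
    logarithm defining \<open>c\<close> nonnegative.\<close>
  define \<theta> where "\<theta> = min 1 \<eta>"
  have \<theta>: "0 < \<theta>" "\<theta> \<le> 1" "\<theta> \<le> \<eta>" using assms by (auto simp: \<theta>_def)
  have Q: "Q \<ge> 1" by (simp add: Q_def)
  define c where "c = sqrt (2 * ln (Q / \<theta>))"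
  have "Q / \<theta> \<ge> 1" using Q \<theta> by (simp add: le_divide_eq)
  then have "c\<^sup>2 = 2 * ln (Q / \<theta>)" by (simp add: c_def)
  then have e: "exp (- c\<^sup>2 / 2) = \<theta> / Q" using Q \<theta> by (simp add: exp_minus)
  show ?thesis
  proof (rule that)
    show "c \<ge> 0" using \<open>Q / \<theta> \<ge> 1\<close> by (simp add: c_def)
    have "\<theta> / Q \<le> \<theta>" using Q \<theta> by (simp add: divide_le_eq)
    then show "exp (- c\<^sup>2 / 2) \<le> \<eta>" using e \<theta> by linarith
    fix r :: nat assume r: "r \<ge> 1"
    have "exp (- (c * sqrt (real r))\<^sup>2 / 2) = exp (real r * (- c\<^sup>2 / 2))"
      by (simp add: power_mult_distrib mult_ac)
    also have "\<dots> = (\<theta> / Q) ^ r" by (simp only: exp_of_nat_mult e)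
    finally have "((2 ^ 16 * 3) ^ r)\<^sup>2 * exp (- (c * sqrt (real r))\<^sup>2 / 2) = Q ^ r * (\<theta> / Q) ^ r"
      by (simp only: Q_def power_mult[symmetric] mult.commute)
    also have "\<dots> = \<theta> ^ r" using Q by (simp add: power_divide)
    also have "\<dots> \<le> \<theta>" using \<theta> r power_decreasing[of 1 r \<theta>] by simp
    finally show "((2 ^ 16 * 3) ^ r)\<^sup>2 * exp (- (c * sqrt (real r))\<^sup>2 / 2) \<le> \<eta>" using \<theta> by simp
  qed
qed

text \<open>Rank 0 would make the form of \<open>A\<close> vanish, against a singular value of at
  least 1. With \<open>r \<ge> 1\<close> the nets are usable and additive constants fit under
  \<open>C\<^sub>0 * sqrt r\<close>.\<close>

lemma rank_pos:
  assumes n: "n \<ge> 1" and A: "A \<in> carrier_mat n n" and s: "largest_singular_value A \<ge> real n"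
  shows "vec_space.rank n A \<ge> 1"
proof (rule ccontr)
  assume "\<not> vec_space.rank n A \<ge> 1"
  then have "vec_space.rank n A = 0" by simp
  then obtain k l u v m where "k = 0"
    "\<And>x y. bilin n n (($$) A) x y = bilin k l m (\<lambda>a. dotp n (u a) x) (\<lambda>b. dotp n (v b) y)"
    using rank_orthonormal_factorization[OF A] by (metis le_zero_eq)
  then have "bilin n n (($$) A) x y = 0" for x y by (simp add: bilin_def[of 0])
  then show False using largest_singular_value_attained[OF n A] n s by auto
qed

section \<open>The norm bound on the whole space\<close>

definition std_basis :: "nat \<Rightarrow> nat \<Rightarrow> real" where
  "std_basis a i = (if a = i then 1 else 0)"

lemma orthonormal_std_basis: "orthonormal n n std_basis"
  unfolding orthonormal_def
proof (intro allI impI)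
  fix a b assume "a < n" "b < n"
  have "dotp n (std_basis a) (std_basis b) = (\<Sum>i<n. if i = a then std_basis b i else 0)"
    unfolding dotp_def by (intro sum.cong) (auto simp: std_basis_def)
  also have "\<dots> = std_basis b a" using \<open>a < n\<close> by simp
  finally show "dotp n (std_basis a) (std_basis b) = (if a = b then 1 else 0)"
    by (auto simp: std_basis_def)
qed

lemma comb_std_basis: "i < n \<Longrightarrow> comb n std_basis x i = x i"
proof -
  assume "i < n"
  have "comb n std_basis x i = (\<Sum>a<n. if a = i then x a else 0)"
    unfolding comb_def by (intro sum.cong) (auto simp: std_basis_def)
  then show ?thesis using \<open>i < n\<close> by simp
qed

text \<open>The whole space is the span of the standard basis, so this is the subspace bound with
  all dimensions equal to \<open>n\<close>.\<close>

lemma norm_tail: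
  assumes "n \<ge> 1" "t \<ge> 0"
  shows "measure_pmf.prob (sign_matrix n) {f. \<exists>x y. bilin n n f x y > 2 * t * norm2 n x * norm2 n y} \<le>
    ((2 ^ 16 * 3) ^ n)\<^sup>2 * exp (- t\<^sup>2 / 2)"
proof -
  have "bilin n n f (comb n std_basis x) (comb n std_basis y) = bilin n n f x y" for f x y
    by (intro bilin_cong) (auto simp: comb_std_basis)
  then show ?thesis
    using compressed_norm_tail[OF assms(1) order_refl order_refl orthonormal_std_basis orthonormal_std_basis assms(2)]
    by simp
qed

lemma prob_bernoulli_matrix_eq:
  "measure_pmf.prob (bernoulli_matrix n) S = measure_pmf.prob (sign_matrix n) {f. Matrix.mat n n f \<in> S}"
  by (simp add: bernoulli_matrix_def signs_pmf_def vimage_def)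

theorem theorem10:
  shows "\<forall>\<epsilon>::real. \<epsilon> > 0 \<longrightarrow> (\<exists>C\<^sub>0::real. C\<^sub>0 > 0 \<and>
    (\<forall>(n::nat) (r::nat) (A::real mat).
       n \<ge> 1 \<longrightarrow> A \<in> carrier_mat n n \<longrightarrow> vec_space.rank n A = r \<longrightarrow>
       largest_singular_value A \<ge> real n \<longrightarrow>
       measure_pmf.prob (bernoulli_matrix n)
         {E. largest_singular_value A - C\<^sub>0 \<le> largest_singular_value (A + E) \<and>
             largest_singular_value (A + E) \<le> largest_singular_value A + C\<^sub>0 * sqrt (real r)}
       \<ge> 1 - \<epsilon>))"
proof (intro allI impI)
  fix \<epsilon> :: real assume \<epsilon>: "\<epsilon> > 0"
  \<comment> \<open>Three bad events each receive a third of \<open>\<epsilon>\<close>, with one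
    common constant \<open>c\<close>.\<close>
  then obtain c where c: "c \<ge> 0" and c_low: "exp (- c\<^sup>2 / 2) \<le> \<epsilon> / 3"
    and c_net: "\<And>r. r \<ge> 1 \<Longrightarrow> ((2 ^ 16 * 3) ^ r)\<^sup>2 * exp (- (c * sqrt (real r))\<^sup>2 / 2) \<le> \<epsilon> / 3"
    using tail_constant[of "\<epsilon> / 3"] by auto
  \<comment> \<open>\<open>2 * c\<close> is the bound on the two spans without its factor
    \<open>sqrt r\<close>, and \<open>10 * c\<^sup>2\<close> is
    \<open>5 * (2 * c)\<^sup>2 / 2\<close> from the absorbed cross terms; the 1 ensures
    positivity.\<close>
  define C\<^sub>0 where "C\<^sub>0 = 1 + 2 * c + 10 * c\<^sup>2"
  have C\<^sub>0: "C\<^sub>0 > 0" "C\<^sub>0 \<ge> c" using c unfolding C\<^sub>0_def by (simp_all add: add_pos_nonneg)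
  have "measure_pmf.prob (bernoulli_matrix n)
         {E. largest_singular_value A - C\<^sub>0 \<le> largest_singular_value (A + E) \<and>
             largest_singular_value (A + E) \<le> largest_singular_value A + C\<^sub>0 * sqrt (real r)} \<ge> 1 - \<epsilon>"
    if n: "n \<ge> 1" and A: "A \<in> carrier_mat n n" and rank: "vec_space.rank n A = r"
      and s: "largest_singular_value A \<ge> real n" for n r :: nat and A :: "real mat"
  proof -
    let ?P = "measure_pmf.prob (sign_matrix n)"
    have r: "r \<ge> 1" using rank_pos[OF n A s] rank by simp
    obtain k l u v m where kl: "k \<le> r" "l \<le> r" and u: "orthonormal n k u" and v: "orthonormal n l v"
      and fact: "\<And>x y. bilin n n (($$) A) x y = bilin k l m (\<lambda>a. dotp n (u a) x) (\<lambda>b. dotp n (v b) y)"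
      using rank_orthonormal_factorization[OF A rank] by metis
    obtain x y where x: "norm2 n x = 1" and y: "norm2 n y = 1"
      and xy: "bilin n n (($$) A) x y = largest_singular_value A"
      using largest_singular_value_attained[OF n A] by blast
    \<comment> \<open>Negating \<open>x\<close> turns the upper tail estimate into one for the lower
      tail at the top pair of \<open>A\<close>.\<close>
    define B1 where "B1 = {f. bilin n n f (\<lambda>i. - 1 * x i) y \<ge> c}"
    define B2 where "B2 = {f. \<exists>x y. bilin n n f x y > 2 * (c * sqrt n) * norm2 n x * norm2 n y}"
    define B3 where "B3 = {f. \<exists>x y. bilin n n f (comb k u x) (comb l v y) >
      2 * (c * sqrt r) * norm2 k x * norm2 l y}"
    define G where "G = {f. largest_singular_value A - C\<^sub>0 \<le> largest_singular_value (A + Matrix.mat n n f) \<and>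
      largest_singular_value (A + Matrix.mat n n f) \<le> largest_singular_value A + C\<^sub>0 * sqrt (real r)}"
    have "?P B1 \<le> exp (- c\<^sup>2 / 2)"
      unfolding B1_def by (rule bilin_tail; simp only: norm2_scale x y c)
    then have B1: "?P B1 \<le> \<epsilon> / 3" using c_low by linarith
    have B2: "?P B2 \<le> \<epsilon> / 3"
      unfolding B2_def using norm_tail[OF n, of "c * sqrt n"] c_net[OF n] c by fastforce
    have B3: "?P B3 \<le> \<epsilon> / 3"
      unfolding B3_def using compressed_norm_tail[OF r kl u v, of "c * sqrt r"] c_net[OF r] c by fastforce
    have good: "f \<in> G" if f: "f \<notin> B1 \<union> B2 \<union> B3" for f
    proof -
      have "- bilin n n f x y < c" using f by (simp add: B1_def bilin_scale_left[of _ _ _ "- 1", simplified])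
      moreover have "bilin n n (($$) (A + Matrix.mat n n f)) x y \<le> largest_singular_value (A + Matrix.mat n n f)"
        using bilin_le_largest_singular_value[OF n, of "A + Matrix.mat n n f" x y] A x y by simp
      moreover have "bilin n n (($$) (A + Matrix.mat n n f)) x y = bilin n n (($$) A) x y + bilin n n f x y"
        unfolding bilin_add_fun[symmetric] using A by (intro bilin_cong) auto
      ultimately have low: "largest_singular_value A - C\<^sub>0 \<le> largest_singular_value (A + Matrix.mat n n f)"
        using xy C\<^sub>0 by linarith
      have up: "largest_singular_value (A + Matrix.mat n n f) \<le>
          largest_singular_value A + 2 * (c * sqrt r) + 5 * (2 * c)\<^sup>2 / 2"
      proof (rule perturbed_singular_value_upper[OF n A s u v fact])
        show "bilin n n f x y \<le> 2 * c * sqrt n * norm2 n x * norm2 n y" for x y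
          using f by (auto simp: B2_def not_less mult.assoc)
        show "bilin n n f (comb k u x) (comb l v y) \<le> 2 * (c * sqrt r) * norm2 k x * norm2 l y" for x y
          using f by (auto simp: B3_def not_less)
      qed (use c in auto)
      have "2 * (c * sqrt r) + 5 * (2 * c)\<^sup>2 / 2 \<le> C\<^sub>0 * sqrt r"
      proof -
        \<comment> \<open>Here \<open>sqrt r \<ge> 1\<close> moves the additive constant under the
          factor \<open>sqrt r\<close>.\<close>
        have "10 * c\<^sup>2 * 1 + 0 \<le> 10 * c\<^sup>2 * sqrt r + sqrt r"
          using r by (intro add_mono mult_left_mono) auto
        then show ?thesis by (simp add: C\<^sub>0_def power_mult_distrib algebra_simps)
      qed
      then have "largest_singular_value (A + Matrix.mat n n f) \<le> largest_singular_value A + C\<^sub>0 * sqrt r"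
        using up by linarith
      then show ?thesis using low by (simp add: G_def)
    qed
    have "1 - ?P G = ?P (- G)" using measure_pmf.prob_compl[of G "sign_matrix n"] by (simp add: Compl_eq_Diff_UNIV)
    also have "\<dots> \<le> ?P (B1 \<union> B2 \<union> B3)" using good by (intro measure_pmf.finite_measure_mono) auto
    also have "\<dots> \<le> ?P B1 + ?P B2 + ?P B3"
      using measure_Un_le[of "B1 \<union> B2" "sign_matrix n" B3] measure_Un_le[of B1 "sign_matrix n" B2] by simp
    finally have "?P G \<ge> 1 - \<epsilon>" using B1 B2 B3 by linarith
    then show ?thesis by (simp add: prob_bernoulli_matrix_eq G_def)
  qed
  then show "\<exists>C\<^sub>0::real. C\<^sub>0 > 0 \<and>
    (\<forall>(n::nat) (r::nat) (A::real mat).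
       n \<ge> 1 \<longrightarrow> A \<in> carrier_mat n n \<longrightarrow> vec_space.rank n A = r \<longrightarrow>
       largest_singular_value A \<ge> real n \<longrightarrow>
       measure_pmf.prob (bernoulli_matrix n)
         {E. largest_singular_value A - C\<^sub>0 \<le> largest_singular_value (A + E) \<and>
             largest_singular_value (A + E) \<le> largest_singular_value A + C\<^sub>0 * sqrt (real r)}
       \<ge> 1 - \<epsilon>)"
    using C\<^sub>0(1) by blast
qed

end
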